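(* Let $\Omega\subset\mathbb{R}^n$ be a smooth bounded domain, let $b=b(x)$ be a bounded function on $\Omega$ such that $\underline{b}\le b(x)\le\overline{b}$ for some constants $\underline{b}$ and $\overline{b}$ with $\overline{b}>0$, let $\lambda>0$ be a parameter, and let $u$ be a positive classical stable solution of $$-\Delta u-b(x)|\nabla u|^2=\lambda e^u\ \text{ in }\Omega,\qquad u=0\ \text{ on }\partial\Omega .$$ Then, for all positive constants $\delta$ and $\eta$ with $\delta^2+\eta^2\le 1$, if $$\overline{b}-\underline{b}<\frac{\delta^2}{\eta^2}\Big(\eta^2-\frac{\overline{b}}{8}\Big),$$ then $$\|e^u\|_{L^q(\Omega)}\le C\quad\text{for}\quad q<1+2\eta^2+2\overline{b}+2\sqrt{\eta^2(\eta^2+\overline{b})-2\overline{b}(\overline{b}-\underline{b})\frac{\eta^2}{\delta^2}},$$ where $C$ depends only on $n$, $b$ and $\Omega$ (in particular, $C$ is independent of $\lambda$).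
   Context: Stability: a classical solution $u$ of $-\Delta u-b(x)|\nabla u|^2=\lambda g(u)$ in $\Omega$, $u=0$ on $\partial\Omega$, is called stable if there exists a function $\phi\in W^{2,p}(\Omega)$ for some $p>n$ such that $\phi>0$ in $\overline{\Omega}$ and $-\Delta\phi-2b(x)\nabla u\cdot\nabla\phi\ge\lambda g'(u)\phi$ in $\Omega$. Here $g(u)=e^u$. *)

theory Defs
  imports "HOL-Analysis.Analysis"
begin

definition partial :: "'n \<Rightarrow> (real^'n \<Rightarrow> real) \<Rightarrow> real^'n \<Rightarrow> real" where
  "partial i f x = frechet_derivative f (at x) (axis i 1)"

definition grad :: "(real^'n \<Rightarrow> real) \<Rightarrow> real^'n \<Rightarrow> real^'n" where
  "grad f x = (\<chi> i. partial i f x)"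

definition laplacian :: "(real^'n \<Rightarrow> real) \<Rightarrow> real^'n \<Rightarrow> real" where
  "laplacian f x = (\<Sum>i\<in>UNIV. partial i (partial i f) x)"

text \<open>The class \<open>C^k(S)\<close>; only meaningful for open \<open>S\<close>, since two-sided derivatives are used.\<close>

fun Ck_on :: "nat \<Rightarrow> (real^'n) set \<Rightarrow> (real^'n \<Rightarrow> real) \<Rightarrow> bool" where
  "Ck_on 0 S f \<longleftrightarrow> continuous_on S f"
| "Ck_on (Suc k) S f \<longleftrightarrow> (\<forall>x\<in>S. f differentiable at x) \<and> (\<forall>i. Ck_on k S (partial i f))"

definition smooth_on :: "(real^'n) set \<Rightarrow> (real^'n \<Rightarrow> real) \<Rightarrow> bool" where
  "smooth_on S f \<longleftrightarrow> (\<forall>k. Ck_on k S f)"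

text \<open>Near each boundary point the domain lies, after choosing a coordinate axis \<open>i\<close> and an
  orientation \<open>s\<close>, strictly on one side of the graph of a smooth function \<open>\<gamma>\<close> of the other
  \<open>n - 1\<close> coordinates. That \<open>\<gamma>\<close> does not depend on the \<open>i\<close>-th coordinate is expressed by
  invariance under translation along the axis.\<close>

definition smooth_boundary :: "(real^'n) set \<Rightarrow> bool" where
  "smooth_boundary \<Omega> \<longleftrightarrow>
     (\<forall>x0\<in>frontier \<Omega>. \<exists>r>0. \<exists>i. \<exists>s\<in>{-1, 1::real}. \<exists>\<gamma>.
        smooth_on UNIV \<gamma> \<and> (\<forall>x t. \<gamma> (x + t *\<^sub>R axis i 1) = \<gamma> x) \<and>
        \<Omega> \<inter> ball x0 r = {x \<in> ball x0 r. s * x $ i > \<gamma> x})"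

definition smooth_bounded_domain :: "(real^'n) set \<Rightarrow> bool" where
  "smooth_bounded_domain \<Omega> \<longleftrightarrow>
     open \<Omega> \<and> connected \<Omega> \<and> \<Omega> \<noteq> {} \<and> bounded \<Omega> \<and> smooth_boundary \<Omega>"

definition in_Lp :: "real \<Rightarrow> (real^'n) set \<Rightarrow> (real^'n \<Rightarrow> real) \<Rightarrow> bool" where
  "in_Lp p \<Omega> f \<longleftrightarrow> f \<in> borel_measurable (lebesgue_on \<Omega>) \<and>
     integrable (lebesgue_on \<Omega>) (\<lambda>x. \<bar>f x\<bar> powr p)"

text \<open>The Bochner integral is \<open>0\<close> for non-integrable functions, so bounds on \<open>Lp_norm\<close>
  are to be stated together with \<open>in_Lp\<close>.\<close>

definition Lp_norm :: "real \<Rightarrow> (real^'n) set \<Rightarrow> (real^'n \<Rightarrow> real) \<Rightarrow> real" where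
  "Lp_norm p \<Omega> f = (\<integral>x. \<bar>f x\<bar> powr p \<partial>lebesgue_on \<Omega>) powr (1 / p)"

definition locally_integrable :: "(real^'n) set \<Rightarrow> (real^'n \<Rightarrow> real) \<Rightarrow> bool" where
  "locally_integrable \<Omega> f \<longleftrightarrow> (\<forall>K. compact K \<and> K \<subseteq> \<Omega> \<longrightarrow> integrable (lebesgue_on K) f)"

definition test_function :: "(real^'n) set \<Rightarrow> (real^'n \<Rightarrow> real) \<Rightarrow> bool" where
  "test_function \<Omega> \<psi> \<longleftrightarrow> smooth_on UNIV \<psi> \<and>
     (\<exists>K. compact K \<and> K \<subseteq> \<Omega> \<and> (\<forall>x. x \<notin> K \<longrightarrow> \<psi> x = 0))"

definition weak_partial ::
  "(real^'n) set \<Rightarrow> 'n \<Rightarrow> (real^'n \<Rightarrow> real) \<Rightarrow> (real^'n \<Rightarrow> real) \<Rightarrow> bool" where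
  "weak_partial \<Omega> i f g \<longleftrightarrow> locally_integrable \<Omega> f \<and> locally_integrable \<Omega> g \<and>
     (\<forall>\<psi>. test_function \<Omega> \<psi> \<longrightarrow>
        (\<integral>x. f x * partial i \<psi> x \<partial>lebesgue_on \<Omega>) = - (\<integral>x. g x * \<psi> x \<partial>lebesgue_on \<Omega>))"

text \<open>The Sobolev space \<open>W^{k,p}(\<Omega>)\<close>, as a predicate on representatives.\<close>

fun sobolev :: "nat \<Rightarrow> real \<Rightarrow> (real^'n) set \<Rightarrow> (real^'n \<Rightarrow> real) \<Rightarrow> bool" where
  "sobolev 0 p \<Omega> f \<longleftrightarrow> in_Lp p \<Omega> f"
| "sobolev (Suc k) p \<Omega> f \<longleftrightarrow> in_Lp p \<Omega> f \<and> (\<forall>i. \<exists>g. weak_partial \<Omega> i f g \<and> sobolev k p \<Omega> g)"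

definition classical_solution ::
  "(real^'n) set \<Rightarrow> (real^'n \<Rightarrow> real) \<Rightarrow> real \<Rightarrow> (real \<Rightarrow> real) \<Rightarrow> (real^'n \<Rightarrow> real) \<Rightarrow> bool" where
  "classical_solution \<Omega> b lam g u \<longleftrightarrow>
     Ck_on 2 \<Omega> u \<and> continuous_on (closure \<Omega>) u \<and>
     (\<forall>x\<in>\<Omega>. - laplacian u x - b x * (norm (grad u x))\<^sup>2 = lam * g (u x)) \<and>
     (\<forall>x\<in>frontier \<Omega>. u x = 0)"

text \<open>As \<open>p > n\<close>, an element \<open>\<phi>\<close> of \<open>W^{2,p}(\<Omega>)\<close> has a unique representative continuous
  on the closure of \<open>\<Omega>\<close>; positivity on the closure refers to that representative. The
  functions \<open>G i\<close> and \<open>H i\<close> are the weak derivatives \<open>\<partial>\<^sub>i\<phi>\<close> and \<open>\<partial>\<^sub>i\<partial>\<^sub>i\<phi>\<close>, unique up to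
  null sets, whence the differential inequality is required almost everywhere.\<close>

definition stable_solution ::
  "(real^'n) set \<Rightarrow> (real^'n \<Rightarrow> real) \<Rightarrow> real \<Rightarrow> (real \<Rightarrow> real) \<Rightarrow> (real^'n \<Rightarrow> real) \<Rightarrow> bool" where
  "stable_solution \<Omega> b lam g u \<longleftrightarrow> classical_solution \<Omega> b lam g u \<and>
     (\<exists>p > real CARD('n). \<exists>\<phi> G H.
        sobolev 2 p \<Omega> \<phi> \<and> continuous_on (closure \<Omega>) \<phi> \<and> (\<forall>x\<in>closure \<Omega>. \<phi> x > 0) \<and>
        (\<forall>i. weak_partial \<Omega> i \<phi> (G i) \<and> weak_partial \<Omega> i (G i) (H i)) \<and>
        (AE x in lebesgue_on \<Omega>.
           - (\<Sum>i\<in>UNIV. H i x) - 2 * b x * (grad u x \<bullet> (\<chi> i. G i x))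
             \<ge> lam * deriv g (u x) * \<phi> x))"

end

theory Submission
  imports Defs
begin

text \<open>Testing the equation with \<open>k(u)\<close> gives \<open>\<integral>(k' - b k)\<bar>\<nabla>u\<bar>\<^sup>2 = \<lambda>\<integral>e\<^sup>u k\<close>, and testing the stability inequality with
  \<open>h(u)\<^sup>2/\<phi>\<close> and completing a square gives \<open>\<lambda>\<integral>e\<^sup>u h\<^sup>2 \<le> \<integral>(h' - b h)\<^sup>2\<bar>\<nabla>u\<bar>\<^sup>2\<close>. If
  \<open>(h' - b h)\<^sup>2 \<le> k' - b k\<close> for all values of \<open>b\<close>, then \<open>\<integral>e\<^sup>u(h\<^sup>2 - k) \<le> 0\<close>, in which \<open>\<lambda>\<close> no longer
  occurs. With \<open>h = r\<^sup>2\<close>, \<open>k = \<kappa> r\<^sup>4 + P r\<^sup>3\<close>, \<open>r = e^(a(u-1)\<^sup>+/2) - 1\<close> this is possible for some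
  \<open>\<kappa> < 1\<close> as soon as \<open>a = 1 + inf b + s \<surd>(1 + inf b)\<close> with \<open>0 < s < 1\<close>; then \<open>h\<^sup>2 - k\<close> grows like \<open>e^(2au)\<close>
  and \<open>\<integral>e^((1+2a)u)\<close> is bounded. The hypotheses on \<open>\<delta>\<close> and \<open>\<eta>\<close> force \<open>q \<le> 1 + 2a\<close> for some such \<open>s\<close>.

  As \<open>r\<close> is supported in the compact set \<open>{u \<ge> 1}\<close>, no boundary regularity enters: \<open>\<phi>\<close> can be mollified,
  and the commutator error tends to \<open>0\<close> in \<open>L\<^sup>1\<close> because \<open>b\<nabla>u\<close> is continuous, even where \<open>b\<close> is not.\<close>

section \<open>Partial derivatives and integration by parts\<close>

text \<open>Differentiability along an axis only: this is all that integration by parts needs, and it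
  spares total differentiability of convolutions.\<close>

definition has_partial :: "(real^'n \<Rightarrow> real) \<Rightarrow> 'n \<Rightarrow> real \<Rightarrow> real^'n \<Rightarrow> bool" where
  "has_partial f i d x \<longleftrightarrow> ((\<lambda>t. f (x + t *\<^sub>R axis i 1)) has_real_derivative d) (at 0)"

lemma has_partial_partial:
  assumes "f differentiable (at x)"
  shows "has_partial f i (partial i f x) x"
proof -
  have D: "(f has_derivative frechet_derivative f (at x)) (at x)"
    using assms by (simp add: frechet_derivative_works)
  have "((\<lambda>t. x + t *\<^sub>R axis i 1) has_derivative (\<lambda>t. t *\<^sub>R axis i (1::real))) (at 0)"
    by (auto intro!: derivative_eq_intros)
  moreover have "(f has_derivative frechet_derivative f (at x)) (at (x + 0 *\<^sub>R axis i 1))"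
    using D by simp
  ultimately have "((\<lambda>t. f (x + t *\<^sub>R axis i 1)) has_derivative
      (\<lambda>t. frechet_derivative f (at x) (t *\<^sub>R axis i 1))) (at 0)"
    by (rule has_derivative_compose)
  moreover have "frechet_derivative f (at x) (t *\<^sub>R axis i 1) = partial i f x * t" for t
    using D by (simp add: partial_def has_derivative_def bounded_linear.linear linear_scale)
  ultimately show ?thesis
    by (simp add: has_partial_def has_field_derivative_def)
qed

lemma has_partial_cong_open:
  assumes "has_partial f i d x" "open S" "x \<in> S" "\<And>y. y \<in> S \<Longrightarrow> f y = g y"
  shows "has_partial g i d x"
proof -
  have "((\<lambda>t. x + t *\<^sub>R axis i (1::real)) \<longlongrightarrow> x + 0 *\<^sub>R axis i 1) (at 0)"
    by (intro tendsto_intros)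
  then have "eventually (\<lambda>t. x + t *\<^sub>R axis i (1::real) \<in> S) (at 0)"
    using assms(2,3) by (intro topological_tendstoD) auto
  then have "eventually (\<lambda>t. x + t *\<^sub>R axis i (1::real) \<in> S) (nhds 0)"
    using assms(3) by (simp add: eventually_at_filter) (auto elim: eventually_mono)
  then have "eventually (\<lambda>t. f (x + t *\<^sub>R axis i (1::real)) = g (x + t *\<^sub>R axis i 1)) (nhds 0)"
    by eventually_elim (simp add: assms(4))
  then show ?thesis
    using assms(1) unfolding has_partial_def by (subst (asm) DERIV_cong_ev) auto
qed

text \<open>\<open>has_partial\<close> looks only at the parameter value 0; this moves it to any
  \<open>s\<close> on the line, because differentiation under the integral asks for a derivative at
  every parameter value.\<close>

lemma has_partial_shift:
  "has_partial f i d (x + s *\<^sub>R axis i 1)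
     \<longleftrightarrow> ((\<lambda>t. f (x + t *\<^sub>R axis i 1)) has_real_derivative d) (at s)"
proof -
  have "(\<lambda>t. f (x + s *\<^sub>R axis i 1 + t *\<^sub>R axis i 1)) = (\<lambda>t. f (x + (t + s) *\<^sub>R axis i 1))"
    by (simp add: algebra_simps)
  then show ?thesis
    unfolding has_partial_def using DERIV_shift[of "\<lambda>t. f (x + t *\<^sub>R axis i 1)" d 0 s] by simp
qed

lemma has_partial_mult:
  "has_partial f i d x \<Longrightarrow> has_partial g i e x
    \<Longrightarrow> has_partial (\<lambda>x. f x * g x) i (d * g x + e * f x) x"
  unfolding has_partial_def by (drule (1) DERIV_mult) simp

lemma has_partial_divide:
  "has_partial f i d x \<Longrightarrow> has_partial g i e x \<Longrightarrow> g x \<noteq> 0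
    \<Longrightarrow> has_partial (\<lambda>x. f x / g x) i ((d * g x - f x * e) / (g x * g x)) x"
  unfolding has_partial_def by (drule (1) DERIV_divide) auto

lemma has_partial_compose:
  "(h has_real_derivative c) (at (f x)) \<Longrightarrow> has_partial f i d x
    \<Longrightarrow> has_partial (\<lambda>x. h (f x)) i (c * d) x"
  unfolding has_partial_def by (rule DERIV_chain2) auto

lemma has_partial_zero: "has_partial (\<lambda>x. 0) i 0 x"
  by (simp add: has_partial_def)

text \<open>By the mean value theorem every difference quotient with increment below 1 is a value of
  \<open>F'\<close>, hence dominated by \<open>w\<close>; dominated convergence along sequences then
  gives the limit.\<close>

lemma has_real_derivative_lebesgue_integral:
  fixes F F' :: "real \<Rightarrow> 'a \<Rightarrow> real"
  assumes int: "\<And>t. integrable M (F t)"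
    and der: "\<And>t y. ((\<lambda>t. F t y) has_real_derivative F' t y) (at t)"
    and bd: "\<And>t y. \<bar>t\<bar> < 1 \<Longrightarrow> \<bar>F' t y\<bar> \<le> w y"
    and w: "integrable M w" and meas: "F' 0 \<in> borel_measurable M"
  shows "((\<lambda>t. \<integral>y. F t y \<partial>M) has_real_derivative (\<integral>y. F' 0 y \<partial>M)) (at 0)"
  unfolding DERIV_def tendsto_at_iff_sequentially
proof (intro allI impI)
  fix X :: "nat \<Rightarrow> real" assume "\<forall>i. X i \<in> UNIV - {0}" and X: "X \<longlonglongrightarrow> 0"
  then have X0: "X n \<noteq> 0" for n by auto
  obtain N where N: "\<And>n. n \<ge> N \<Longrightarrow> \<bar>X n\<bar> < 1"
    using LIMSEQ_D[OF X, of 1] by auto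
  \<comment> \<open>The bound \<open>w\<close> is available only for
    \<open>\<bar>t\<bar> < 1\<close>, so the finitely many larger increments are cut off here;
    \<open>LIMSEQ_offset\<close> puts them back at the end.\<close>
  define Y where "Y n = X (n + N)" for n
  have Y: "Y \<longlonglongrightarrow> 0" "\<And>n. Y n \<noteq> 0" "\<And>n. \<bar>Y n\<bar> < 1"
    unfolding Y_def using X0 N LIMSEQ_ignore_initial_segment[OF X, of N] by auto
  have lim: "(\<lambda>n. \<integral>y. (F (Y n) y - F 0 y) / Y n \<partial>M) \<longlonglongrightarrow> (\<integral>y. F' 0 y \<partial>M)"
  proof (rule integral_dominated_convergence[OF meas _ w])
    show "(\<lambda>y. (F (Y n) y - F 0 y) / Y n) \<in> borel_measurable M" for n
      using int by (intro borel_measurable_divide borel_measurable_diff borel_measurable_integrable) auto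
    have "(\<lambda>n. (F (Y n) y - F 0 y) / Y n) \<longlonglongrightarrow> F' 0 y" for y
      using der[of y 0] Y(1,2) unfolding DERIV_def tendsto_at_iff_sequentially
      by (auto simp: o_def)
    then show "AE y in M. (\<lambda>n. (F (Y n) y - F 0 y) / Y n) \<longlonglongrightarrow> F' 0 y" by simp
    have "\<bar>(F t y - F 0 y) / t\<bar> \<le> w y" if t: "t \<noteq> 0" "\<bar>t\<bar> < 1" for t y
    proof -
      obtain z where z: "\<bar>z\<bar> < 1" "F t y - F 0 y = t * F' z y"
      proof (cases "t > 0")
        case True
        from MVT2[OF this, of "\<lambda>t. F t y" "\<lambda>t. F' t y"] der obtain z
          where "0 < z" "z < t" "F t y - F 0 y = (t - 0) * F' z y" by blast
        then show ?thesis using that[of z] t by auto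
      next
        case False
        then have "t < 0" using t by simp
        from MVT2[OF this, of "\<lambda>t. F t y" "\<lambda>t. F' t y"] der obtain z
          where "t < z" "z < 0" "F 0 y - F t y = (0 - t) * F' z y" by blast
        then show ?thesis using that[of z] t by auto
      qed
      then show ?thesis using bd t by simp
    qed
    then show "AE y in M. norm ((F (Y n) y - F 0 y) / Y n) \<le> w y" for n
      using Y by simp
  qed
  have eq: "(\<integral>y. (F (Y n) y - F 0 y) / Y n \<partial>M)
      = ((\<integral>y. F (0 + Y n) y \<partial>M) - (\<integral>y. F 0 y \<partial>M)) / Y n" for n
    using int by (simp add: Bochner_Integration.integral_diff)
  have "(\<lambda>n. ((\<integral>y. F (0 + Y n) y \<partial>M) - (\<integral>y. F 0 y \<partial>M)) / Y n) \<longlonglongrightarrow> (\<integral>y. F' 0 y \<partial>M)"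
    using lim unfolding eq .
  then show "((\<lambda>h. ((\<integral>y. F (0 + h) y \<partial>M) - (\<integral>y. F 0 y \<partial>M)) / h) \<circ> X) \<longlonglongrightarrow> (\<integral>y. F' 0 y \<partial>M)"
    unfolding o_def Y_def by (rule LIMSEQ_offset)
qed

lemma integrable_continuous_compact_support:
  fixes f :: "'a::euclidean_space \<Rightarrow> real"
  assumes "continuous_on UNIV f" "compact K" "\<And>x. x \<notin> K \<Longrightarrow> f x = 0"
  shows "integrable lborel f"
proof -
  have "integrable lborel (\<lambda>x. indicator K x *\<^sub>R f x)"
    using assms(1,2) by (intro borel_integrable_compact) (auto intro: continuous_on_subset)
  also have "(\<lambda>x. indicator K x *\<^sub>R f x) = f"
    using assms(3) by (auto simp: indicator_def fun_eq_iff)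
  finally show ?thesis .
qed

lemma bounded_continuous_compact_support:
  fixes f :: "'a::euclidean_space \<Rightarrow> real"
  assumes "continuous_on UNIV f" "compact K" "\<And>x. x \<notin> K \<Longrightarrow> f x = 0"
  obtains M where "M \<ge> 0" "\<And>x. \<bar>f x\<bar> \<le> M"
proof -
  have "compact (f ` K)"
    using assms(1,2) by (intro compact_continuous_image) (auto intro: continuous_on_subset)
  then have "bounded (f ` K)" by (rule compact_imp_bounded)
  then obtain M where M: "\<And>x. x \<in> K \<Longrightarrow> \<bar>f x\<bar> \<le> M"
    unfolding bounded_iff by auto
  show ?thesis
  proof (rule that[of "max M 0"])
    show "\<bar>f x\<bar> \<le> max M 0" for x using M[of x] assms(3)[of x] by (cases "x \<in> K") auto
  qed simp
qed

lemma lborel_integral_translate: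
  fixes f :: "'a::euclidean_space \<Rightarrow> real"
  assumes "f \<in> borel_measurable borel"
  shows "(\<integral>x. f (x + c) \<partial>lborel) = (\<integral>x. f x \<partial>lborel)"
proof -
  have "(\<integral>x. f x \<partial>lborel) = (\<integral>x. f x \<partial>distr lborel borel ((+) c))"
    by (simp add: lborel_distr_plus)
  also have "\<dots> = (\<integral>x. f (c + x) \<partial>lborel)"
    using assms by (intro integral_distr) auto
  finally show ?thesis by (simp add: add.commute)
qed

text \<open>The integral of \<open>f (y + t *\<^sub>R axis i 1)\<close> over \<open>y\<close> does
  not depend on \<open>t\<close>, by translation invariance. Its derivative at 0 is therefore 0, and
  differentiation under the integral identifies that derivative with the integral of
  \<open>f'\<close>.\<close>

lemma integral_partial_eq_0:
  assumes f: "continuous_on UNIV f" and f': "continuous_on UNIV f'" and K: "compact K"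
    and supp: "\<And>x. x \<notin> K \<Longrightarrow> f x = 0" "\<And>x. x \<notin> K \<Longrightarrow> f' x = 0"
    and der: "\<And>x. has_partial f i (f' x) x"
  shows "(\<integral>x. f' x \<partial>lborel) = 0"
proof -
  let ?e = "axis i (1::real)"
  \<comment> \<open>\<open>K\<close> swept along the axis: it contains every \<open>y\<close> that a
    shift of length at most 1 carries into \<open>K\<close>, so a multiple of a single indicator
    dominates all the shifted derivatives.\<close>
  define K' where "K' = (\<lambda>(x, t). x + t *\<^sub>R ?e) ` (K \<times> {-1..1})"
  have K': "compact K'"
    unfolding K'_def using K by (intro compact_continuous_image compact_Times)
      (auto simp: split_beta intro!: continuous_intros)
  obtain M where M: "M \<ge> 0" "\<And>x. \<bar>f' x\<bar> \<le> M"
    using bounded_continuous_compact_support[OF f' K supp(2)] by blast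
  have meas: "f \<in> borel_measurable borel" "f' \<in> borel_measurable borel"
    using f f' by (auto intro: borel_measurable_continuous_onI)
  have "((\<lambda>t. \<integral>y. f (y + t *\<^sub>R ?e) \<partial>lborel) has_real_derivative (\<integral>y. f' (y + 0 *\<^sub>R ?e) \<partial>lborel)) (at 0)"
  proof (rule has_real_derivative_lebesgue_integral[where w = "\<lambda>y. M * indicator K' y"])
    show "integrable lborel (\<lambda>y. f (y + t *\<^sub>R ?e))" for t
    proof (rule integrable_continuous_compact_support)
      show "continuous_on UNIV (\<lambda>y. f (y + t *\<^sub>R ?e))"
        by (intro continuous_on_compose2[OF f] continuous_intros) auto
      show "compact ((\<lambda>x. x - t *\<^sub>R ?e) ` K)"
        using K by (intro compact_continuous_image continuous_intros)
      show "f (y + t *\<^sub>R ?e) = 0" if "y \<notin> (\<lambda>x. x - t *\<^sub>R ?e) ` K" for y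
        using that by (intro supp(1)) (auto simp: image_def)
    qed
    show "((\<lambda>t. f (y + t *\<^sub>R ?e)) has_real_derivative f' (y + t *\<^sub>R ?e)) (at t)" for t y
      using der by (simp flip: has_partial_shift)
    show "\<bar>f' (y + t *\<^sub>R ?e)\<bar> \<le> M * indicator K' y" if "\<bar>t\<bar> < 1" for t y
    proof (cases "y \<in> K'")
      case False
      have "y + t *\<^sub>R ?e \<notin> K"
      proof
        assume *: "y + t *\<^sub>R ?e \<in> K"
        then have "(\<lambda>(x, t). x + t *\<^sub>R ?e) (y + t *\<^sub>R ?e, - t) \<in> K'"
          unfolding K'_def using that by (intro imageI) auto
        then show False using False by simp
      qed
      then show ?thesis using supp(2) M by simp
    qed (use M in simp)
    show "integrable lborel (\<lambda>y. M * indicator K' y :: real)"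
      using borel_integrable_compact[OF K', of "\<lambda>_. M"] by (simp add: mult.commute)
    show "(\<lambda>y. f' (y + 0 *\<^sub>R ?e)) \<in> borel_measurable lborel" using meas by simp
  qed
  moreover have "(\<lambda>t. \<integral>y. f (y + t *\<^sub>R ?e) \<partial>lborel) = (\<lambda>t. \<integral>y. f y \<partial>lborel)"
    using lborel_integral_translate[of f] meas(1) by blast
  ultimately have "((\<lambda>t. \<integral>y. f y \<partial>lborel) has_real_derivative (\<integral>y. f' y \<partial>lborel)) (at (0::real))"
    by simp
  from DERIV_unique[OF this DERIV_const] show ?thesis .
qed

section \<open>A smooth kernel\<close>

text \<open>The classical flat function, with an extra factor of order \<open>k\<close> in the
  reciprocal: differentiation produces such factors, and the index makes the linear span of the
  family closed under it.\<close>

definition flat :: "nat \<Rightarrow> real \<Rightarrow> real" where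
  "flat k t = (if t > 0 then (1 / t) ^ k * exp (- (1 / t)) else 0)"

text \<open>This is the difference quotient at 0. From the right, substituting the reciprocal of
  \<open>t\<close> reduces it to the decay of a power divided by the exponential at
  infinity.\<close>

lemma flat_tendsto_0: "((\<lambda>t. flat k t / t) \<longlongrightarrow> 0) (at 0)"
proof -
  have "((\<lambda>s. s ^ Suc k / exp s) \<longlongrightarrow> (0::real)) at_top"
    by (rule tendsto_power_div_exp_0)
  then have "((\<lambda>t. inverse t ^ Suc k / exp (inverse t)) \<longlongrightarrow> (0::real)) (at_right 0)"
    by (rule filterlim_compose) (rule filterlim_inverse_at_top_right)
  moreover have "eventually (\<lambda>t. inverse t ^ Suc k / exp (inverse t) = flat k t / t) (at_right (0::real))"
    unfolding eventually_at_filter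
    by (rule always_eventually) (auto simp: flat_def exp_minus field_simps)
  ultimately have r: "((\<lambda>t. flat k t / t) \<longlongrightarrow> 0) (at_right 0)"
    by (rule Lim_transform_eventually)
  have "((\<lambda>t. flat k t / t) \<longlongrightarrow> 0) (at_left 0)"
    by (rule tendsto_eventually) (auto simp: eventually_at_filter flat_def)
  with r show ?thesis by (simp add: filterlim_at_split)
qed

lemma DERIV_flat: "(flat k has_real_derivative flat (k + 2) t - real k * flat (k + 1) t) (at t)"
proof -
  consider "t > 0" | "t < 0" | "t = 0" by linarith
  then show ?thesis
  proof cases
    case 1
    have "((\<lambda>t. (1 / t) ^ k * exp (- (1 / t))) has_real_derivative
            flat (k + 2) t - real k * flat (k + 1) t) (at t)"
      using 1 by (auto intro!: derivative_eq_intros simp: flat_def)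
        (cases k; simp add: field_simps power2_eq_square)
    then show ?thesis
      by (rule has_field_derivative_transform_within_open[where S = "{0<..}"])
        (use 1 in \<open>auto simp: flat_def\<close>)
  next
    case 2
    have "((\<lambda>t. 0) has_real_derivative flat (k + 2) t - real k * flat (k + 1) t) (at t)"
      using 2 by (simp add: flat_def)
    then show ?thesis
      by (rule has_field_derivative_transform_within_open[where S = "{..<0}"])
        (use 2 in \<open>auto simp: flat_def\<close>)
  next
    case 3
    then show ?thesis using flat_tendsto_0[of k] by (simp add: DERIV_def flat_def)
  qed
qed

text \<open>A class of functions closed under partial derivatives, rich enough to contain a bump function.\<close>

inductive smooth_term :: "(real^'n \<Rightarrow> real) \<Rightarrow> bool" where
  flat: "smooth_term (\<lambda>x. flat k (c + s * x $ i))"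
| const: "smooth_term (\<lambda>x. c)"
| add: "smooth_term f \<Longrightarrow> smooth_term g \<Longrightarrow> smooth_term (\<lambda>x. f x + g x)"
| mult: "smooth_term f \<Longrightarrow> smooth_term g \<Longrightarrow> smooth_term (\<lambda>x. f x * g x)"

lemma smooth_term_prod:
  assumes "finite I" "\<And>i. i \<in> I \<Longrightarrow> smooth_term (f i)"
  shows "smooth_term (\<lambda>x. \<Prod>i\<in>I. f i x)"
  using assms by (induction I rule: finite_induct) (auto intro: smooth_term.intros)

text \<open>The affine argument in the generator \<open>flat\<close> absorbs the reflection. It is
  what makes a reflected kernel usable as a test function.\<close>

lemma smooth_term_reflect: "smooth_term f \<Longrightarrow> smooth_term (\<lambda>y. f (x - y))"
proof (induction rule: smooth_term.induct)
  case (flat k c s i)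
  have "smooth_term (\<lambda>y. flat k ((c + s * x $ i) + (- s) * y $ i))"
    by (rule smooth_term.flat)
  then show ?case by (simp add: algebra_simps)
qed (auto intro: smooth_term.intros)

text \<open>The induction produces the total derivative, as \<open>Ck_on\<close> demands
  differentiability, together with coefficients in the same class, so that it can be iterated to
  every order.\<close>

lemma smooth_term_has_derivative:
  assumes "smooth_term f"
  shows "\<exists>D. (\<forall>j. smooth_term (D j)) \<and>
    (\<forall>x. (f has_derivative (\<lambda>h. \<Sum>j\<in>UNIV. D j x * h $ j)) (at x))"
  using assms
proof (induction rule: smooth_term.induct)
  case (flat k c s i)
  define D where "D j x = (if j = i then s else 0) *
    (flat (k + 2) (c + s * x $ i) + (- real k) * flat (k + 1) (c + s * x $ i))" for j x
  have "smooth_term (D j)" for j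
    unfolding D_def by (intro smooth_term.intros)
  moreover have "((\<lambda>x. flat k (c + s * x $ i)) has_derivative (\<lambda>h. \<Sum>j\<in>UNIV. D j x * h $ j)) (at x)" for x
  proof -
    have "(flat k has_derivative (\<lambda>h. h * (flat (k + 2) (c + s * x $ i) - real k * flat (k + 1) (c + s * x $ i))))
        (at (c + s * x $ i))"
      using DERIV_flat[of k "c + s * x $ i"] by (simp add: has_field_derivative_def mult_commute_abs)
    moreover have "((\<lambda>x. c + s * x $ i) has_derivative (\<lambda>h. s * h $ i)) (at x)"
      by (auto intro!: derivative_eq_intros bounded_linear_imp_has_derivative bounded_linear_vec_nth)
    ultimately have "((\<lambda>x. flat k (c + s * x $ i)) has_derivative
        (\<lambda>h. s * h $ i * (flat (k + 2) (c + s * x $ i) - real k * flat (k + 1) (c + s * x $ i)))) (at x)"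
      by (rule has_derivative_compose[rotated])
    moreover have "(\<Sum>j\<in>UNIV. D j x * h $ j) =
        s * h $ i * (flat (k + 2) (c + s * x $ i) - real k * flat (k + 1) (c + s * x $ i))" for h
      by (simp add: D_def if_distrib if_distribR sum.delta cong: if_cong)
    ultimately show ?thesis by simp
  qed
  ultimately show ?case by blast
next
  case (const c)
  show ?case by (intro exI[of _ "\<lambda>j x. 0"]) (auto intro: smooth_term.const)
next
  case (add f g)
  then obtain D E where D: "\<And>j. smooth_term (D j)" "\<And>j. smooth_term (E j)"
    and *: "\<And>x. (f has_derivative (\<lambda>h. \<Sum>j\<in>UNIV. D j x * h $ j)) (at x)"
      "\<And>x. (g has_derivative (\<lambda>h. \<Sum>j\<in>UNIV. E j x * h $ j)) (at x)" by blast
  show ?case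
  proof (intro exI[of _ "\<lambda>j x. D j x + E j x"] conjI allI)
    show "((\<lambda>x. f x + g x) has_derivative (\<lambda>h. \<Sum>j\<in>UNIV. (D j x + E j x) * h $ j)) (at x)" for x
      using has_derivative_add[OF *(1)[of x] *(2)[of x]] by (simp add: sum.distrib distrib_right)
  qed (auto intro: smooth_term.add D)
next
  case (mult f g)
  then obtain D E where D: "\<And>j. smooth_term (D j)" "\<And>j. smooth_term (E j)"
    and *: "\<And>x. (f has_derivative (\<lambda>h. \<Sum>j\<in>UNIV. D j x * h $ j)) (at x)"
      "\<And>x. (g has_derivative (\<lambda>h. \<Sum>j\<in>UNIV. E j x * h $ j)) (at x)" by blast
  show ?case
  proof (intro exI[of _ "\<lambda>j x. f x * E j x + D j x * g x"] conjI allI)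
    show "((\<lambda>x. f x * g x) has_derivative (\<lambda>h. \<Sum>j\<in>UNIV. (f x * E j x + D j x * g x) * h $ j)) (at x)" for x
      using has_derivative_mult[OF *(1)[of x] *(2)[of x]]
      by (simp add: sum.distrib distrib_right sum_distrib_left sum_distrib_right algebra_simps)
    show "smooth_term (\<lambda>x. f x * E j x + D j x * g x)" for j
      by (intro smooth_term.add smooth_term.mult D mult.hyps)
  qed
qed

lemma smooth_term_partial:
  assumes "smooth_term f"
  shows "f differentiable (at x)" "smooth_term (partial i f)"
proof -
  obtain D where D: "\<And>j. smooth_term (D j)"
    and *: "\<And>x. (f has_derivative (\<lambda>h. \<Sum>j\<in>UNIV. D j x * h $ j)) (at x)"
    using smooth_term_has_derivative[OF assms] by blast
  show "f differentiable (at x)" using * by (auto simp: differentiable_def)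
  have "partial i f x = D i x" for x
    using frechet_derivative_at[OF *[of x], symmetric]
    by (simp add: partial_def axis_def if_distrib sum.delta cong: if_cong)
  then have "partial i f = D i" by auto
  with D show "smooth_term (partial i f)" by simp
qed

lemma smooth_term_smooth_on: "smooth_term f \<Longrightarrow> smooth_on UNIV f"
proof -
  have "Ck_on k UNIV f" if "smooth_term f" for k f
    using that
  proof (induction k arbitrary: f)
    case 0
    then show ?case
      by (auto intro!: continuous_at_imp_continuous_on differentiable_imp_continuous_within smooth_term_partial)
  qed (auto intro: smooth_term_partial)
  then show "smooth_term f \<Longrightarrow> smooth_on UNIV f" unfolding smooth_on_def by blast
qed

lemma smooth_term_continuous: "smooth_term f \<Longrightarrow> continuous_on S f"
  by (auto intro!: continuous_at_imp_continuous_on differentiable_imp_continuous_within smooth_term_partial)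

lemma partial_eq_0_outside:
  assumes "closed S" "\<And>x. x \<notin> S \<Longrightarrow> f x = 0" "x \<notin> S"
  shows "partial i f x = 0"
proof -
  have "((\<lambda>x. 0) has_derivative (\<lambda>h. 0)) (at x)" by simp
  then have "(f has_derivative (\<lambda>h. 0)) (at x)"
    by (rule has_derivative_transform_within_open[where s = "- S"]) (use assms in auto)
  from frechet_derivative_at[OF this] show ?thesis by (metis partial_def)
qed

lemma partial_reflect:
  assumes "f differentiable (at (x - y))"
  shows "partial i (\<lambda>y. f (x - y)) y = - partial i f (x - y)"
proof -
  have D: "(f has_derivative frechet_derivative f (at (x - y))) (at (x - y))"
    using assms by (simp add: frechet_derivative_works)
  have "((\<lambda>y. x - y) has_derivative (\<lambda>h. - h)) (at y)"
    by (auto intro!: derivative_eq_intros)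
  from has_derivative_compose[OF this D]
  have "((\<lambda>y. f (x - y)) has_derivative (\<lambda>h. frechet_derivative f (at (x - y)) (- h))) (at y)" .
  from frechet_derivative_at[OF this, symmetric] show ?thesis
    using D by (simp add: partial_def has_derivative_def bounded_linear.linear linear_neg)
qed

text \<open>A product over the coordinates of one-dimensional bumps, divided by its integral.
  Pairing the factors for \<open>d + x $ i\<close> and \<open>d - x $ i\<close> makes it
  even.\<close>

lemma exists_smooth_kernel:
  assumes "0 < e"
  shows "\<exists>\<rho> :: real^'n \<Rightarrow> real. smooth_term \<rho> \<and> (\<forall>x. 0 \<le> \<rho> x) \<and> (\<forall>x. \<rho> (- x) = \<rho> x) \<and> (\<forall>x. x \<notin> cball 0 e \<longrightarrow> \<rho> x = 0)
    \<and> integrable lborel \<rho> \<and> (\<integral>x. \<rho> x \<partial>lborel) = 1"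
proof -
  \<comment> \<open>The product lives in a cube of half-width \<open>d\<close>. There the l1 norm is
    at most \<open>CARD('n)\<close> times \<open>d\<close>, that is \<open>e\<close>, which puts the
    cube inside the ball.\<close>
  define d where "d = e / real CARD('n)"
  have d: "d > 0" using assms by (simp add: d_def)
  define f :: "real^'n \<Rightarrow> real" where "f x = (\<Prod>i\<in>UNIV. flat 0 (d + 1 * x $ i) * flat 0 (d + (-1) * x $ i))" for x
  have f: "smooth_term f"
    unfolding f_def by (intro smooth_term_prod smooth_term.intros) auto
  have pos: "f x \<ge> 0" for x
    unfolding f_def by (intro prod_nonneg) (auto simp: flat_def)
  have even: "f (- x) = f x" for x
    unfolding f_def by (intro prod.cong) (auto simp: mult.commute)
  have "f 0 > 0"
    unfolding f_def by (intro prod_pos) (auto simp: flat_def d)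
  have supp: "f x = 0" if "x \<notin> cball 0 e" for x
  proof (rule ccontr)
    assume "f x \<noteq> 0"
    then have "flat 0 (d + x $ i) \<noteq> 0 \<and> flat 0 (d - x $ i) \<noteq> 0" for i
      by (simp add: f_def)
    then have "\<bar>x $ i\<bar> \<le> d" for i
      by (auto simp: flat_def abs_le_iff split: if_splits) (smt (verit))+
    then have "(\<Sum>i\<in>UNIV. \<bar>x $ i\<bar>) \<le> (\<Sum>i\<in>(UNIV :: 'n set). d)"
      by (intro sum_mono) auto
    also have "\<dots> = e" by (simp add: d_def)
    finally have "norm x \<le> e" using norm_le_l1_cart[of x] by linarith
    with that show False by simp
  qed
  have cont: "continuous_on UNIV f" using f by (rule smooth_term_continuous)
  have int: "integrable lborel f"
  proof -
    have "integrable lborel (\<lambda>x. indicator (cball 0 e) x *\<^sub>R f x)"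
      using cont by (intro borel_integrable_compact) (auto intro: continuous_on_subset)
    also have "(\<lambda>x. indicator (cball 0 e) x *\<^sub>R f x) = f"
      using supp by (auto simp: indicator_def fun_eq_iff simp del: mem_cball)
    finally show ?thesis .
  qed
  define Z where "Z = (\<integral>x. f x \<partial>lborel)"
  have "Z \<noteq> 0"
  proof
    assume "Z = 0"
    then have "AE x in lborel. f x = 0"
      using int pos by (simp add: Z_def integral_nonneg_eq_0_iff_AE)
    \<comment> \<open>A closed set of full measure is the whole space, so it would contain 0, where
      \<open>f\<close> is positive.\<close>
    then have "AE x in lebesgue. x \<in> {x. f x \<le> 0}"
      by (intro AE_completion) auto
    moreover have "closed {x. f x \<le> 0}"
      using cont by (intro closed_Collect_le) auto
    ultimately have "0 \<in> {x. f x \<le> 0}"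
      by (intro mem_closed_if_AE_lebesgue) auto
    with \<open>f 0 > 0\<close> show False by simp
  qed
  moreover have "Z \<ge> 0" unfolding Z_def using pos by (intro integral_nonneg_AE) auto
  ultimately have Z: "Z > 0" by simp
  show ?thesis
  proof (intro exI[of _ "\<lambda>x. inverse Z * f x"] conjI allI impI)
    show "(\<integral>x. inverse Z * f x \<partial>lborel) = 1"
      using Z by (simp add: Z_def)
  qed (use Z pos even supp int smooth_term.mult[OF smooth_term.const f] in \<open>auto simp del: mem_cball\<close>)
qed

section \<open>Convolution and weak derivatives\<close>

definition conv :: "(real^'n \<Rightarrow> real) \<Rightarrow> (real^'n \<Rightarrow> real) \<Rightarrow> real^'n \<Rightarrow> real" where
  "conv g \<rho> x = (\<integral>y. g y * \<rho> (x - y) \<partial>lborel)"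

lemma conv_integrable:
  fixes g \<rho> :: "real^'n \<Rightarrow> real"
  assumes g: "integrable lborel g" and \<rho>: "continuous_on UNIV \<rho>"
    and S: "compact S" "\<And>z. z \<notin> S \<Longrightarrow> \<rho> z = 0"
  shows "integrable lborel (\<lambda>y. g y * \<rho> (x - y))"
proof -
  obtain M where M: "\<And>z. \<bar>\<rho> z\<bar> \<le> M"
    using bounded_continuous_compact_support[OF \<rho> S] by blast
  have [measurable]: "(\<lambda>y. \<rho> (x - y)) \<in> borel_measurable borel"
    by (intro borel_measurable_continuous_onI continuous_on_compose2[OF \<rho>] continuous_intros) auto
  have [measurable]: "g \<in> borel_measurable borel"
    using g by auto
  show ?thesis
  proof (rule Bochner_Integration.integrable_bound)
    show "integrable lborel (\<lambda>y. g y * M)" using g by simp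
    show "AE y in lborel. norm (g y * \<rho> (x - y)) \<le> norm (g y * M)"
      using order_trans[OF M abs_ge_self] by (intro AE_I2) (simp add: abs_mult mult_left_mono)
  qed auto
qed

lemma conv_continuous:
  fixes g \<rho> :: "real^'n \<Rightarrow> real"
  assumes g: "integrable lborel g" and \<rho>: "continuous_on UNIV \<rho>"
    and S: "compact S" "\<And>z. z \<notin> S \<Longrightarrow> \<rho> z = 0"
  shows "continuous_on UNIV (conv g \<rho>)"
proof (rule continuous_at_imp_continuous_on, rule ballI, rule continuous_at_sequentiallyI)
  fix x and X :: "nat \<Rightarrow> real^'n" assume X: "X \<longlonglongrightarrow> x"
  obtain M where M: "\<And>z. \<bar>\<rho> z\<bar> \<le> M"
    using bounded_continuous_compact_support[OF \<rho> S] by blast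
  have "(\<lambda>n. \<integral>y. g y * \<rho> (X n - y) \<partial>lborel) \<longlonglongrightarrow> (\<integral>y. g y * \<rho> (x - y) \<partial>lborel)"
  proof (rule integral_dominated_convergence[where w = "\<lambda>y. \<bar>g y\<bar> * M"])
    show "integrable lborel (\<lambda>y. \<bar>g y\<bar> * M)" using g by simp
    show "AE y in lborel. norm (g y * \<rho> (X n - y)) \<le> \<bar>g y\<bar> * M" for n
      using M by (intro AE_I2) (simp add: abs_mult mult_left_mono)
    show "AE y in lborel. (\<lambda>n. g y * \<rho> (X n - y)) \<longlonglongrightarrow> g y * \<rho> (x - y)"
    proof (intro AE_I2 tendsto_mult tendsto_const)
      fix y
      show "(\<lambda>n. \<rho> (X n - y)) \<longlonglongrightarrow> \<rho> (x - y)"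
        using X by (intro continuous_on_tendsto_compose[OF \<rho>] tendsto_intros) auto
    qed
  qed (use conv_integrable[OF assms] in \<open>auto intro: borel_measurable_integrable\<close>)
  then show "(\<lambda>n. conv g \<rho> (X n)) \<longlonglongrightarrow> conv g \<rho> x" by (simp add: conv_def)
qed

lemma conv_has_partial:
  assumes g: "integrable lborel g" and \<rho>: "smooth_term \<rho>"
    and S: "compact S" "\<And>z. z \<notin> S \<Longrightarrow> \<rho> z = 0"
  shows "has_partial (conv g \<rho>) i (conv g (partial i \<rho>) x) x"
proof -
  let ?e = "axis i (1::real)"
  note \<rho>' = smooth_term_partial(2)[OF \<rho>, of i]
  have S': "partial i \<rho> z = 0" if "z \<notin> S" for z
    using partial_eq_0_outside[OF compact_imp_closed[OF S(1)] S(2) that] .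
  obtain M where M: "M \<ge> 0" "\<And>z. \<bar>partial i \<rho> z\<bar> \<le> M"
    using bounded_continuous_compact_support[OF smooth_term_continuous[OF \<rho>'] S(1) S'] by blast
  have "((\<lambda>t. \<integral>y. g y * \<rho> (x + t *\<^sub>R ?e - y) \<partial>lborel) has_real_derivative
      (\<integral>y. g y * partial i \<rho> (x + 0 *\<^sub>R ?e - y) \<partial>lborel)) (at 0)"
  proof (rule has_real_derivative_lebesgue_integral[where w = "\<lambda>y. \<bar>g y\<bar> * M"])
    show "integrable lborel (\<lambda>y. g y * \<rho> (x + t *\<^sub>R ?e - y))" for t
      by (rule conv_integrable[OF g smooth_term_continuous[OF \<rho>] S])
    show "((\<lambda>t. g y * \<rho> (x + t *\<^sub>R ?e - y)) has_real_derivative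
        g y * partial i \<rho> (x + t *\<^sub>R ?e - y)) (at t)" for t y
    proof -
      have "has_partial \<rho> i (partial i \<rho> ((x - y) + t *\<^sub>R ?e)) ((x - y) + t *\<^sub>R ?e)"
        by (intro has_partial_partial smooth_term_partial \<rho>)
      then have "((\<lambda>t. \<rho> ((x - y) + t *\<^sub>R ?e)) has_real_derivative
          partial i \<rho> ((x - y) + t *\<^sub>R ?e)) (at t)"
        by (simp only: has_partial_shift)
      then have "((\<lambda>t. g y * \<rho> ((x - y) + t *\<^sub>R ?e)) has_real_derivative
          g y * partial i \<rho> ((x - y) + t *\<^sub>R ?e)) (at t)"
        by (rule DERIV_cmult)
      then show ?thesis by (simp add: algebra_simps)
    qed
    show "\<bar>g y * partial i \<rho> (x + t *\<^sub>R ?e - y)\<bar> \<le> \<bar>g y\<bar> * M" for t y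
      using M by (simp add: abs_mult mult_left_mono)
    show "integrable lborel (\<lambda>y. \<bar>g y\<bar> * M)" using g by simp
    show "(\<lambda>y. g y * partial i \<rho> (x + 0 *\<^sub>R ?e - y)) \<in> borel_measurable lborel"
      by (rule borel_measurable_integrable,
          rule conv_integrable[OF g smooth_term_continuous[OF \<rho>'] S(1) S'])
  qed
  then show ?thesis by (simp add: has_partial_def conv_def)
qed

text \<open>Tonelli's theorem, each translate of \<open>\<rho>\<close> having mass 1. It bounds the
  mollification error by a constant that is the same for all kernels.\<close>

lemma conv_integral:
  fixes g :: "real^'n \<Rightarrow> real"
  assumes g: "integrable lborel g" "\<And>x. 0 \<le> g x" and \<rho>: "continuous_on UNIV \<rho>" "\<And>x. 0 \<le> \<rho> x"
    and S: "compact S" "\<And>z. z \<notin> S \<Longrightarrow> \<rho> z = 0" and 1: "(\<integral>x. \<rho> x \<partial>lborel) = 1"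
  shows "integrable lborel (conv g \<rho>)" "(\<integral>x. conv g \<rho> x \<partial>lborel) = (\<integral>x. g x \<partial>lborel)"
proof -
  have [measurable]: "\<rho> \<in> borel_measurable borel" "g \<in> borel_measurable borel"
    using \<rho> g by (auto intro: borel_measurable_continuous_onI)
  have int: "integrable lborel \<rho>"
    using integrable_continuous_compact_support[OF \<rho>(1) S] .
  have nn: "(\<integral>\<^sup>+x. ennreal (\<rho> (x - y)) \<partial>lborel) = 1" for y
  proof -
    have "(\<integral>\<^sup>+x. ennreal (\<rho> x) \<partial>lborel) = (\<integral>\<^sup>+x. ennreal (\<rho> x) \<partial>distr lborel borel ((+) (- y)))"
      by (simp only: lborel_distr_plus)
    also have "\<dots> = (\<integral>\<^sup>+x. ennreal (\<rho> (- y + x)) \<partial>lborel)"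
      by (intro nn_integral_distr) auto
    finally show ?thesis using nn_integral_eq_integral[OF int] \<rho>(2) 1 by simp
  qed
  have conv0: "conv g \<rho> x \<ge> 0" for x
    unfolding conv_def using g \<rho> by (intro integral_nonneg_AE AE_I2) simp
  have meas: "conv g \<rho> \<in> borel_measurable lborel"
    using conv_continuous[OF g(1) \<rho>(1) S] by (auto intro: borel_measurable_continuous_onI)
  have "(\<integral>\<^sup>+x. ennreal (conv g \<rho> x) \<partial>lborel)
      = (\<integral>\<^sup>+x. \<integral>\<^sup>+y. ennreal (g y * \<rho> (x - y)) \<partial>lborel \<partial>lborel)"
  proof (intro nn_integral_cong)
    fix x
    show "ennreal (conv g \<rho> x) = (\<integral>\<^sup>+y. ennreal (g y * \<rho> (x - y)) \<partial>lborel)"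
      unfolding conv_def using conv_integrable[OF g(1) \<rho>(1) S] g(2) \<rho>(2)
      by (intro nn_integral_eq_integral[symmetric]) auto
  qed
  also have "\<dots> = (\<integral>\<^sup>+y. \<integral>\<^sup>+x. ennreal (g y * \<rho> (x - y)) \<partial>lborel \<partial>lborel)"
    by (rule lborel_pair.Fubini') auto
  also have "\<dots> = (\<integral>\<^sup>+y. ennreal (g y) * (\<integral>\<^sup>+x. ennreal (\<rho> (x - y)) \<partial>lborel) \<partial>lborel)"
    using g(2) \<rho>(2) by (intro nn_integral_cong) (simp add: ennreal_mult nn_integral_cmult)
  also have "\<dots> = ennreal (\<integral>x. g x \<partial>lborel)"
    using nn g by (simp add: nn_integral_eq_integral)
  finally have *: "(\<integral>\<^sup>+x. ennreal (conv g \<rho> x) \<partial>lborel) = ennreal (\<integral>x. g x \<partial>lborel)" .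
  show "integrable lborel (conv g \<rho>)"
    using * meas conv0 by (intro integrableI_nn_integral_finite) auto
  show "(\<integral>x. conv g \<rho> x \<partial>lborel) = (\<integral>x. g x \<partial>lborel)"
    using * meas conv0 g(2) by (subst integral_eq_nn_integral) (auto intro!: enn2real_ennreal integral_nonneg_AE)
qed

text \<open>A Borel representative, to which Fubini's theorem for \<^const>\<open>lborel\<close> applies.\<close>

definition truncation :: "(real^'n) set \<Rightarrow> (real^'n \<Rightarrow> real) \<Rightarrow> (real^'n \<Rightarrow> real) \<Rightarrow> bool" where
  "truncation K f f' \<longleftrightarrow> integrable lborel f' \<and> (AE x in lborel. f' x = indicator K x * f x)"

lemma truncation_exists:
  assumes "locally_integrable \<Omega> f" "compact K" "K \<subseteq> \<Omega>"
  obtains f' where "truncation K f f'"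
proof -
  have K: "K \<in> sets lebesgue" using assms(2) by (simp add: lmeasurable_compact fmeasurableD)
  have "integrable (lebesgue_on K) f"
    using assms by (auto simp: locally_integrable_def)
  then have int: "integrable lebesgue (\<lambda>x. indicator K x * f x)"
    using K by (simp add: integrable_restrict_space)
  then have "(\<lambda>x. indicator K x * f x) \<in> borel_measurable (completion lborel)" by auto
  from completion_ex_borel_measurable_real[OF this] obtain f' where
    f': "f' \<in> borel_measurable lborel" "AE x in lborel. indicator K x * f x = f' x"
    by (elim bexE) (rule that)
  have "integrable lebesgue f'"
    by (rule iffD1[OF integrable_cong_AE[OF _ _ AE_completion[OF f'(2)]] int])
      (use int f'(1) in \<open>auto intro: measurable_completion\<close>)
  then have "integrable lborel f'" using f'(1) by (simp add: integrable_completion)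
  moreover have "AE x in lborel. f' x = indicator K x * f x" using f'(2) by auto
  ultimately show ?thesis using that by (simp add: truncation_def)
qed

text \<open>Since \<open>\<psi>\<close> vanishes off \<open>K\<close>, neither cutting
  \<open>f\<close> off outside \<open>K\<close> nor changing it on a null set affects the
  integral.\<close>

lemma truncation_integral:
  assumes tr: "truncation K f f'" and \<Omega>: "open \<Omega>" and K: "compact K" "K \<subseteq> \<Omega>"
    and \<psi>: "continuous_on UNIV \<psi>" "\<And>x. x \<notin> K \<Longrightarrow> \<psi> x = 0"
  shows "(\<integral>x. f x * \<psi> x \<partial>lebesgue_on \<Omega>) = (\<integral>x. f' x * \<psi> x \<partial>lborel)"
proof -
  have meas: "\<psi> \<in> borel_measurable lborel" "f' \<in> borel_measurable lborel"
    using \<psi> tr by (auto simp: truncation_def intro: borel_measurable_continuous_onI)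
  have ae: "AE x in lebesgue. f' x * \<psi> x = indicator \<Omega> x * (f x * \<psi> x)"
  proof (rule AE_completion)
    have "AE x in lborel. f' x = indicator K x * f x"
      using tr by (simp add: truncation_def)
    then show "AE x in lborel. f' x * \<psi> x = indicator \<Omega> x * (f x * \<psi> x)"
      by eventually_elim (use K(2) \<psi>(2) in \<open>auto simp: indicator_def\<close>)
  qed
  have m: "(\<lambda>x. f' x * \<psi> x) \<in> borel_measurable lebesgue"
    using meas by (intro measurable_completion) auto
  have "(\<integral>x. f x * \<psi> x \<partial>lebesgue_on \<Omega>) = (\<integral>x. indicator \<Omega> x * (f x * \<psi> x) \<partial>lebesgue)"
    using \<Omega> by (simp add: integral_restrict_space)
  also have "\<dots> = (\<integral>x. f' x * \<psi> x \<partial>lebesgue)"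
    by (rule integral_cong_AE[OF m borel_measurable_AE[OF m ae] ae, symmetric])
  also have "\<dots> = (\<integral>x. f' x * \<psi> x \<partial>lborel)"
    using meas by (intro integral_completion) auto
  finally show ?thesis .
qed

text \<open>The test function is the kernel reflected about \<open>x\<close>. The sign from
  differentiating the reflection cancels the sign in the definition of the weak derivative.\<close>

lemma weak_partial_conv:
  assumes w: "weak_partial \<Omega> i f g" and \<Omega>: "open \<Omega>" and K: "compact K" "K \<subseteq> \<Omega>"
    and tr: "truncation K f f'" "truncation K g g'"
    and \<rho>: "smooth_term \<rho>" "\<And>z. z \<notin> cball 0 e \<Longrightarrow> \<rho> z = 0" and x: "cball x e \<subseteq> K"
  shows "conv f' (partial i \<rho>) x = conv g' \<rho> x"
proof -
  define \<psi> where "\<psi> y = \<rho> (x - y)" for y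
  have supp: "x - y \<notin> cball 0 e" if "y \<notin> K" for y
    using that x by (auto simp: subset_iff dist_norm norm_minus_commute)
  have \<psi>: "smooth_term \<psi>"
    unfolding \<psi>_def by (rule smooth_term_reflect[OF \<rho>(1)])
  have p: "partial i \<psi> y = - partial i \<rho> (x - y)" for y
    unfolding \<psi>_def by (intro partial_reflect smooth_term_partial \<rho>)
  have z: "partial i \<rho> (x - y) = 0" if "y \<notin> K" for y
    using partial_eq_0_outside[OF closed_cball \<rho>(2) supp[OF that]] .
  have "test_function \<Omega> \<psi>"
    unfolding test_function_def using smooth_term_smooth_on[OF \<psi>] K \<rho>(2) supp
    by (auto simp: \<psi>_def intro!: exI[of _ K])
  then have *: "(\<integral>y. f y * partial i \<psi> y \<partial>lebesgue_on \<Omega>) = - (\<integral>y. g y * \<psi> y \<partial>lebesgue_on \<Omega>)"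
    using w by (simp add: weak_partial_def)
  have "(\<integral>y. f y * partial i \<psi> y \<partial>lebesgue_on \<Omega>) = (\<integral>y. f' y * partial i \<psi> y \<partial>lborel)"
    by (intro truncation_integral[OF tr(1) \<Omega> K] smooth_term_continuous smooth_term_partial \<psi>)
      (simp add: p z)
  moreover have "(\<integral>y. g y * \<psi> y \<partial>lebesgue_on \<Omega>) = (\<integral>y. g' y * \<psi> y \<partial>lborel)"
    by (intro truncation_integral[OF tr(2) \<Omega> K] smooth_term_continuous \<psi>)
      (unfold \<psi>_def, rule \<rho>(2)[OF supp])
  ultimately show ?thesis using * by (simp add: p conv_def \<psi>_def)
qed

section \<open>The weight functions\<close>

definition trunc_exp :: "real \<Rightarrow> real \<Rightarrow> real" where
  "trunc_exp a t = exp (a / 2 * max 0 (t - 1)) - 1"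

lemma trunc_exp_eq_0: "t \<le> 1 \<Longrightarrow> trunc_exp a t = 0"
  by (simp add: trunc_exp_def)

lemma trunc_exp_nonneg: "0 \<le> a \<Longrightarrow> 0 \<le> trunc_exp a t"
  by (simp add: trunc_exp_def)

lemma continuous_on_trunc_exp: "continuous_on UNIV (trunc_exp a)"
  unfolding trunc_exp_def by (intro continuous_intros)

text \<open>\<open>trunc_exp\<close> itself has a kink at 1 unless \<open>a\<close> is 0; any power
  with exponent at least 2 removes it. Elsewhere this is the chain rule.\<close>

lemma DERIV_trunc_exp_power:
  "((\<lambda>t. trunc_exp a t ^ Suc (Suc m)) has_real_derivative
     real (Suc (Suc m)) * trunc_exp a t ^ Suc m * (a / 2 * (trunc_exp a t + 1))) (at t)"
proof -
  consider "t > 1" | "t < 1" | "t = 1" by linarith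
  then show ?thesis
  proof cases
    case 1
    have "((\<lambda>t. (exp (a / 2 * (t - 1)) - 1) ^ Suc (Suc m)) has_real_derivative
        real (Suc (Suc m)) * trunc_exp a t ^ Suc m * (a / 2 * (trunc_exp a t + 1))) (at t)"
      using 1 by (auto intro!: derivative_eq_intros simp: trunc_exp_def simp del: power_Suc)
    then show ?thesis
      by (rule has_field_derivative_transform_within_open[where S = "{1<..}"])
        (use 1 in \<open>auto simp: trunc_exp_def\<close>)
  next
    case 2
    have "((\<lambda>t. 0) has_real_derivative
        real (Suc (Suc m)) * trunc_exp a t ^ Suc m * (a / 2 * (trunc_exp a t + 1))) (at t)"
      using 2 by (simp add: trunc_exp_eq_0)
    then show ?thesis
      by (rule has_field_derivative_transform_within_open[where S = "{..<1}"])
        (use 2 in \<open>auto simp: trunc_exp_def\<close>)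
  next
    case 3
    \<comment> \<open>The power without truncation, centred at the kink. It has derivative 0 there,
      and the truncated power equals either \<open>g h\<close> or 0, so its difference quotient is
      squeezed to 0.\<close>
    define g where "g h = (exp (a / 2 * h) - 1) ^ Suc (Suc m)" for h :: real
    have "(g has_real_derivative 0) (at 0)"
      unfolding g_def by (auto intro!: derivative_eq_intros)
    then have "((\<lambda>h. g h / h) \<longlongrightarrow> 0) (at 0)"
      by (simp add: DERIV_def g_def)
    then have "((\<lambda>h. trunc_exp a (1 + h) ^ Suc (Suc m) / h) \<longlongrightarrow> 0) (at 0)"
      by (rule Lim_null_comparison[rotated, OF tendsto_norm_zero])
        (auto simp: trunc_exp_def g_def max_def divide_le_0_iff intro!: always_eventually)
    then show ?thesis using 3 by (simp add: DERIV_def trunc_exp_eq_0)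
  qed
qed

text \<open>With \<open>r\<close> standing for \<open>trunc_exp a t\<close>,
  \<open>h = r\<^sup>2\<close> has derivative \<open>a * r * (r + 1)\<close>, and the right-hand
  side is \<open>k' - b k\<close> for \<open>k = \<kappa> * r ^ 4 + P * r ^ 3\<close>. Both sides
  are polynomials in \<open>r\<close> with the powers 2, 3 and 4, and are compared coefficient by
  coefficient. The fourth power decides the admissible \<open>a\<close>; a large \<open>P\<close>
  settles the other two.\<close>

lemma exists_weight_constants:
  fixes blow bup s R :: real
  assumes R: "0 < R" "R\<^sup>2 = 1 + blow" and s: "0 < s" "s < 1" and b: "0 < bup" "bup < 1 + blow"
  defines "a \<equiv> R\<^sup>2 + s * R"
  shows "\<exists>\<kappa> P. \<kappa> < 1 \<and> 0 \<le> P \<and> (\<forall>b r. blow \<le> b \<and> b \<le> bup \<and> 0 \<le> r \<longrightarrow>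
     (a * r * (r + 1) - b * r\<^sup>2)\<^sup>2 \<le>
     \<kappa> * (2 * a * r ^ 3 * (r + 1)) + P * (3 / 2 * a * r\<^sup>2 * (r + 1)) - b * (\<kappa> * r ^ 4 + P * r ^ 3))"
proof -
  define \<mu> where "\<mu> = R\<^sup>2 * (1 - s\<^sup>2)"
  have sR: "0 < s * R" using R s by simp
  have s2: "s\<^sup>2 < 1" using s by (simp add: power_less_one_iff)
  have \<mu>: "0 < \<mu>" "\<mu> \<le> a"
  proof -
    show "0 < \<mu>" unfolding \<mu>_def using R(1) s2 by (intro mult_pos_pos) auto
    have "\<mu> \<le> R\<^sup>2" unfolding \<mu>_def by (intro mult_left_le) auto
    then show "\<mu> \<le> a" using sR by (simp add: a_def)
  qed
  have x1: "a - blow = 1 + s * R" using R by (simp add: a_def)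
  have abup: "bup < a" using b R sR by (simp add: a_def)
  have a: "0 < a" using abup b by simp
  \<comment> \<open>With \<open>x = a - b\<close> the leading coefficient is \<open>a + x - x\<^sup>2\<close>, concave in \<open>x\<close>, equal to \<open>\<mu>\<close> at \<open>b = blow\<close>.\<close>
  have quad: "\<mu> + (a - b)\<^sup>2 \<le> 2 * a - b" if "blow \<le> b" "b \<le> bup" for b
  proof -
    define x where "x = a - b"
    have x: "0 \<le> x" "x \<le> 1 + s * R" using that x1 abup by (auto simp: x_def)
    have "\<mu> + x\<^sup>2 \<le> a + x"
    proof (cases "x \<le> 1")
      case True
      then have "x\<^sup>2 \<le> x" using x by (simp add: power2_eq_square mult_left_le)
      then show ?thesis using \<mu> by linarith
    next
      case False
      have "0 \<le> (1 + s * R - x) * (s * R + x)" using x False sR by (intro mult_nonneg_nonneg) auto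
      also have "\<dots> = (1 + s * R)\<^sup>2 - (1 + s * R) + x - x\<^sup>2"
        by (simp add: power2_eq_square algebra_simps)
      finally have "x\<^sup>2 - x \<le> (1 + s * R)\<^sup>2 - (1 + s * R)" by simp
      also have "\<dots> = a - \<mu>" by (simp add: a_def \<mu>_def power2_eq_square algebra_simps)
      finally show ?thesis by simp
    qed
    then show ?thesis by (simp add: x_def)
  qed
  \<comment> \<open>\<open>M\<close> bounds \<open>2 * a - b\<close> for all admissible
    \<open>b\<close>. With \<open>\<kappa> = 1 - \<mu> / M\<close> the additive slack
    \<open>\<mu>\<close> becomes a factor below 1 that does not depend on \<open>b\<close>.\<close>
  define M where "M = 2 * a - blow"
  have M: "0 < M" using a x1 sR by (simp add: M_def)
  define \<kappa> where "\<kappa> = 1 - \<mu> / M"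
  \<comment> \<open>The summand \<open>4 * (a - blow)\<close> pays for the cubic coefficient, using
    \<open>3 / 2 * a - b \<ge> a / 2\<close>; the summand \<open>a\<close> pays for the quadratic
    one.\<close>
  define P where "P = 4 * (a - blow) + a"
  have P: "0 \<le> P" using x1 sR a by (simp add: P_def)
  have ablow: "0 \<le> a - blow" using x1 sR by simp
  have "(a * r * (r + 1) - b * r\<^sup>2)\<^sup>2 \<le>
     \<kappa> * (2 * a * r ^ 3 * (r + 1)) + P * (3 / 2 * a * r\<^sup>2 * (r + 1)) - b * (\<kappa> * r ^ 4 + P * r ^ 3)"
    if bb: "blow \<le> b" "b \<le> bup" and r: "0 \<le> r" for b r
  proof -
    have pos: "0 \<le> 2 * a - b" "2 * a - b \<le> M" using bb abup a by (auto simp: M_def)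
    have "\<mu> / M * (2 * a - b) \<le> \<mu> / M * M"
      using pos M \<mu> by (intro mult_left_mono) auto
    then have "\<mu> / M * (2 * a - b) \<le> \<mu>" using M by simp
    then have c4: "(a - b)\<^sup>2 \<le> \<kappa> * (2 * a - b)"
      using quad[OF bb] by (simp add: \<kappa>_def left_diff_distrib)
    have kap: "0 \<le> \<kappa>"
    proof -
      have "blow \<le> bup" using bb by simp
      then have "\<mu> \<le> M" using quad[of blow] by (simp add: M_def) (smt (verit) zero_le_power2)
      then show ?thesis using M by (simp add: \<kappa>_def)
    qed
    have "2 * a * (a - b) \<le> 2 * a * (a - blow)" using a bb by simp
    also have "\<dots> \<le> P * (a / 2)"
    proof -
      have "2 * a * (a - blow) = 4 * (a - blow) * (a / 2)" by simp
      also have "\<dots> \<le> P * (a / 2)" using a by (intro mult_right_mono) (auto simp: P_def)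
      finally show ?thesis .
    qed
    also have "\<dots> \<le> P * (3 / 2 * a - b)"
      using P abup bb by (intro mult_left_mono) auto
    also have "\<dots> \<le> 2 * a * \<kappa> + P * (3 / 2 * a - b)" using a kap by simp
    finally have c3: "2 * a * (a - b) \<le> 2 * a * \<kappa> + P * (3 / 2 * a - b)" .
    have c2: "a\<^sup>2 \<le> 3 / 2 * a * P"
    proof -
      have "a * a \<le> a * P" using a ablow by (intro mult_left_mono) (auto simp: P_def)
      also have "\<dots> \<le> 3 / 2 * (a * P)" using a P by simp
      finally show ?thesis by (simp add: power2_eq_square)
    qed
    have "(a * r * (r + 1) - b * r\<^sup>2)\<^sup>2
        = (a - b)\<^sup>2 * r ^ 4 + 2 * a * (a - b) * r ^ 3 + a\<^sup>2 * r\<^sup>2"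
      by (simp add: power2_eq_square power3_eq_cube power4_eq_xxxx algebra_simps)
    also have "\<dots> \<le> \<kappa> * (2 * a - b) * r ^ 4 + (2 * a * \<kappa> + P * (3 / 2 * a - b)) * r ^ 3
        + 3 / 2 * a * P * r\<^sup>2"
      using c4 c3 c2 r by (intro add_mono mult_right_mono) auto
    also have "\<dots> = \<kappa> * (2 * a * r ^ 3 * (r + 1)) + P * (3 / 2 * a * r\<^sup>2 * (r + 1)) - b * (\<kappa> * r ^ 4 + P * r ^ 3)"
      by (simp add: power2_eq_square power3_eq_cube power4_eq_xxxx algebra_simps)
    finally show ?thesis .
  qed
  moreover have "\<kappa> < 1" using M \<mu> by (simp add: \<kappa>_def)
  ultimately show ?thesis using P by blast
qed

text \<open>For large \<open>t\<close> the quartic term beats the cubic one, and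
  \<open>exp t * (r + 1) ^ 4\<close> is \<open>exp ((1 + 2 * a) * t)\<close> up to the factor
  \<open>exp (2 * a)\<close>, where \<open>r\<close> is \<open>trunc_exp a t\<close>. On the
  remaining compact interval continuity bounds the difference.\<close>

lemma exp_le_weight:
  fixes a c P q :: real
  assumes a: "0 < a" and c: "0 < c" and P: "0 \<le> P" and q: "q \<le> 1 + 2 * a"
  shows "\<exists>A B. 0 \<le> B \<and> (\<forall>t\<ge>1. exp (q * t) \<le>
     A + B * (exp t * (c * trunc_exp a t ^ 4 - P * trunc_exp a t ^ 3)))"
proof -
  \<comment> \<open>From \<open>r0\<close> on, the cubic term is at most half of the quartic one,
    and \<open>r + 1 \<le> 2 * r\<close>. The constant 32 in \<open>B\<close> is that 2 times the
    fourth power of this 2; \<open>exp (2 * a)\<close> undoes the shift by 1 in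
    \<open>trunc_exp\<close>.\<close>
  define r0 where "r0 = max 1 (2 * P / c)"
  define B where "B = 32 * exp (2 * a) / c"
  have B: "0 \<le> B" using c by (simp add: B_def)
  \<comment> \<open>The point at which \<open>trunc_exp a\<close> takes the value
    \<open>r0\<close>.\<close>
  define t0 where "t0 = 1 + 2 / a * ln (1 + r0)"
  define F where "F t = exp (q * t) - B * (exp t * (c * trunc_exp a t ^ 4 - P * trunc_exp a t ^ 3))" for t
  have "continuous_on {1..t0} F"
    unfolding F_def by (intro continuous_intros continuous_on_subset[OF continuous_on_trunc_exp]) auto
  then have "compact (F ` {1..t0})" by (intro compact_continuous_image) auto
  then have "bounded (F ` {1..t0})" by (rule compact_imp_bounded)
  then obtain A where A: "\<And>t. t \<in> {1..t0} \<Longrightarrow> \<bar>F t\<bar> \<le> A"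
    unfolding bounded_iff by (metis imageI real_norm_def)
  have "F t \<le> max A 0" if t: "1 \<le> t" for t
  proof (cases "t \<le> t0")
    case True
    then show ?thesis using A[of t] t by auto
  next
    case False
    define r where "r = trunc_exp a t"
    have r1: "r + 1 = exp (a / 2 * (t - 1))" using t by (simp add: r_def trunc_exp_def)
    have r0: "1 \<le> r0" "2 * P \<le> c * r0" using c by (auto simp: r0_def field_simps max_def)
    have "ln (1 + r0) \<le> a / 2 * (t - 1)"
      using False a by (simp add: t0_def field_simps)
    then have "exp (ln (1 + r0)) \<le> r + 1" unfolding r1 by simp
    then have rr: "r0 \<le> r" using r0 by simp
    then have r: "1 \<le> r" "2 * P \<le> c * r" using r0 c by (auto intro: order_trans[OF _ mult_left_mono[of r0 r c]])
    have "2 * P * r ^ 3 \<le> c * r * r ^ 3" using r by (intro mult_right_mono) auto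
    then have "c / 2 * r ^ 4 \<le> c * r ^ 4 - P * r ^ 3"
      by (simp add: power3_eq_cube power4_eq_xxxx algebra_simps)
    moreover have "(r + 1) ^ 4 \<le> (2 * r) ^ 4" using r by (intro power_mono) auto
    then have "c / 32 * (r + 1) ^ 4 \<le> c / 2 * r ^ 4" using c by (simp add: power_mult_distrib)
    ultimately have *: "c / 32 * (r + 1) ^ 4 \<le> c * r ^ 4 - P * r ^ 3" by linarith
    have "exp (q * t) \<le> exp ((1 + 2 * a) * t)" using q t by simp
    also have "\<dots> = exp t * (exp (2 * a) * (r + 1) ^ 4)"
      unfolding r1 by (simp add: exp_of_nat_mult[symmetric] exp_add[symmetric] field_simps)
    also have "\<dots> = B * (exp t * (c / 32 * (r + 1) ^ 4))" using c by (simp add: B_def)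
    also have "\<dots> \<le> B * (exp t * (c * r ^ 4 - P * r ^ 3))"
      using * B by (intro mult_left_mono) auto
    finally have "F t \<le> 0" by (simp add: F_def r_def)
    then show ?thesis by simp
  qed
  then have "exp (q * t) \<le> max A 0 + B * (exp t * (c * trunc_exp a t ^ 4 - P * trunc_exp a t ^ 3))"
    if "1 \<le> t" for t using that by (fastforce simp: F_def)
  with B show ?thesis by blast
qed

text \<open>The gap \<open>bup - blow\<close> is below \<open>\<delta>\<^sup>2\<close>, so
  \<open>\<eta>\<^sup>2 + bup < 1 + blow\<close>. Writing \<open>R\<close> for the root of
  \<open>1 + blow\<close>, the square root in the bound on \<open>q\<close> is then at most
  \<open>R\<close>, and \<open>q\<close> lies strictly below
  \<open>1 + 2 * R\<^sup>2 + 2 * R\<close>, the limit of the attainable exponents as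
  \<open>s\<close> tends to 1.\<close>

lemma exponent_below_threshold:
  fixes blow bup \<delta> \<eta> q :: real
  assumes b: "blow \<le> bup" "0 < bup" and de: "0 < \<delta>" "0 < \<eta>" "\<delta>\<^sup>2 + \<eta>\<^sup>2 \<le> 1"
    and d: "bup - blow < \<delta>\<^sup>2 / \<eta>\<^sup>2 * (\<eta>\<^sup>2 - bup / 8)"
    and q: "q < 1 + 2 * \<eta>\<^sup>2 + 2 * bup
          + 2 * sqrt (\<eta>\<^sup>2 * (\<eta>\<^sup>2 + bup) - 2 * bup * (bup - blow) * (\<eta>\<^sup>2 / \<delta>\<^sup>2))"
  shows "bup < 1 + blow"
    "\<exists>s. 0 < s \<and> s < 1 \<and> q \<le> 1 + 2 * ((sqrt (1 + blow))\<^sup>2 + s * sqrt (1 + blow))"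
proof -
  have "\<delta>\<^sup>2 / \<eta>\<^sup>2 * (\<eta>\<^sup>2 - bup / 8) = \<delta>\<^sup>2 - \<delta>\<^sup>2 / \<eta>\<^sup>2 * (bup / 8)"
    using de by (simp add: field_simps)
  also have "\<dots> \<le> \<delta>\<^sup>2" using b de by simp
  finally have gap: "bup - blow < \<delta>\<^sup>2" using d by linarith
  have R2: "\<eta>\<^sup>2 + bup < 1 + blow" using gap de by linarith
  moreover have "0 < \<eta>\<^sup>2" using de by simp
  ultimately show "bup < 1 + blow" by linarith
  define R where "R = sqrt (1 + blow)"
  have R: "0 < R" "R\<^sup>2 = 1 + blow" using \<open>bup < 1 + blow\<close> b by (auto simp: R_def)
  have "\<eta>\<^sup>2 \<le> 1" using de by (smt (verit) zero_le_power2)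
  have "\<eta>\<^sup>2 * (\<eta>\<^sup>2 + bup) - 2 * bup * (bup - blow) * (\<eta>\<^sup>2 / \<delta>\<^sup>2) \<le> \<eta>\<^sup>2 * (\<eta>\<^sup>2 + bup)"
    using b by simp
  also have "\<dots> \<le> 1 * R\<^sup>2"
    using \<open>\<eta>\<^sup>2 \<le> 1\<close> R2 R b by (intro mult_mono) auto
  finally have "sqrt (\<eta>\<^sup>2 * (\<eta>\<^sup>2 + bup) - 2 * bup * (bup - blow) * (\<eta>\<^sup>2 / \<delta>\<^sup>2)) \<le> R"
    using R by (intro real_le_lsqrt) auto
  then have q': "q < 1 + 2 * R\<^sup>2 + 2 * R" using q R2 R by linarith
  \<comment> \<open>The second entry solves \<open>q = 1 + 2 * (R\<^sup>2 + s * R)\<close>; the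
    first only keeps \<open>s\<close> positive.\<close>
  define s where "s = max (1 / 2) ((q - 1 - 2 * R\<^sup>2) / (2 * R))"
  have "0 < s" "s < 1" using q' R by (auto simp: s_def field_simps)
  moreover have "(q - 1 - 2 * R\<^sup>2) / (2 * R) \<le> s" by (simp add: s_def)
  then have "q \<le> 1 + 2 * (R\<^sup>2 + s * R)" using R by (simp add: field_simps)
  ultimately show "\<exists>s. 0 < s \<and> s < 1 \<and> q \<le> 1 + 2 * ((sqrt (1 + blow))\<^sup>2 + s * sqrt (1 + blow))"
    unfolding R_def by blast
qed

section \<open>The mollified stability inequality\<close>

text \<open>Quotients by a mollified \<open>\<phi>\<close> are under control only near
  \<open>K\<close>. Extension by zero is continuous and has the right partial derivatives on each of
  the two open sets \<open>U\<close> and \<open>- K\<close>, which cover the space.\<close>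

lemma integral_partial_eq_0_on:
  fixes f f' :: "real^'n \<Rightarrow> real"
  assumes U: "open U" and K: "compact K" "K \<subseteq> U"
    and cont: "continuous_on U f" "continuous_on U f'"
    and zero: "\<And>x. x \<in> U - K \<Longrightarrow> f x = 0" "\<And>x. x \<in> U - K \<Longrightarrow> f' x = 0"
    and der: "\<And>x. x \<in> U \<Longrightarrow> has_partial f i (f' x) x"
  shows "integrable lborel (\<lambda>x. indicator K x * f' x)"
    and "(\<integral>x. indicator K x * f' x \<partial>lborel) = 0"
proof -
  define F where "F x = indicator K x * f x" for x
  define F' where "F' x = indicator K x * f' x" for x
  have op: "open (- K)" using K(1) by (auto dest: compact_imp_closed)
  have un: "U \<union> - K = UNIV" using K(2) by auto
  have eq: "F x = f x" "F' x = f' x" if "x \<in> U" for x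
    using zero that by (auto simp: F_def F'_def indicator_def)
  have "continuous_on (U \<union> - K) F"
  proof (rule continuous_on_open_Un[OF U op])
    show "continuous_on U F" using cont(1) by (simp add: eq cong: continuous_on_cong)
    have "continuous_on (- K) (\<lambda>x. 0 :: real)" by simp
    then show "continuous_on (- K) F" by (rule continuous_on_eq) (simp add: F_def)
  qed
  then have F: "continuous_on UNIV F" by (simp only: un)
  have "continuous_on (U \<union> - K) F'"
  proof (rule continuous_on_open_Un[OF U op])
    show "continuous_on U F'" using cont(2) by (simp add: eq cong: continuous_on_cong)
    have "continuous_on (- K) (\<lambda>x. 0 :: real)" by simp
    then show "continuous_on (- K) F'" by (rule continuous_on_eq) (simp add: F'_def)
  qed
  then have F': "continuous_on UNIV F'" by (simp only: un)
  have D: "has_partial F i (F' x) x" for x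
  proof (cases "x \<in> U")
    case True
    then show ?thesis using has_partial_cong_open[OF der[OF True] U True] by (simp add: eq)
  next
    case False
    then have x: "x \<in> - K" using K(2) by auto
    show ?thesis
      using has_partial_cong_open[OF has_partial_zero op x, of F i] x by (simp add: F_def F'_def)
  qed
  have z: "F x = 0" "F' x = 0" if "x \<notin> K" for x
    using that by (auto simp: F_def F'_def)
  show "integrable lborel (\<lambda>x. indicator K x * f' x)"
    using integrable_continuous_compact_support[OF F' K(1) z(2)] by (simp add: F'_def)
  show "(\<integral>x. indicator K x * f' x \<partial>lborel) = 0"
    using integral_partial_eq_0[OF F F' K(1) z D] by (simp add: F'_def)
qed

lemma conv_add:
  fixes g h \<rho> :: "real^'n \<Rightarrow> real"
  assumes "integrable lborel g" "integrable lborel h" "continuous_on UNIV \<rho>"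
    and "compact S" "\<And>z. z \<notin> S \<Longrightarrow> \<rho> z = 0"
  shows "conv (\<lambda>y. g y + h y) \<rho> x = conv g \<rho> x + conv h \<rho> x"
  unfolding conv_def distrib_right using assms
  by (intro Bochner_Integration.integral_add conv_integrable[OF _ assms(3-5)])

lemma conv_diff:
  fixes g h \<rho> :: "real^'n \<Rightarrow> real"
  assumes "integrable lborel g" "integrable lborel h" "continuous_on UNIV \<rho>"
    and "compact S" "\<And>z. z \<notin> S \<Longrightarrow> \<rho> z = 0"
  shows "conv (\<lambda>y. g y - h y) \<rho> x = conv g \<rho> x - conv h \<rho> x"
  unfolding conv_def left_diff_distrib using assms
  by (intro Bochner_Integration.integral_diff conv_integrable[OF _ assms(3-5)])

lemma conv_sum:
  fixes g :: "'i \<Rightarrow> real^'n \<Rightarrow> real"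
  assumes "\<And>i. i \<in> I \<Longrightarrow> integrable lborel (g i)" "continuous_on UNIV \<rho>"
    and "compact S" "\<And>z. z \<notin> S \<Longrightarrow> \<rho> z = 0"
  shows "conv (\<lambda>y. \<Sum>i\<in>I. g i y) \<rho> x = (\<Sum>i\<in>I. conv (g i) \<rho> x)"
  unfolding conv_def sum_distrib_right using assms(1)
  by (intro Bochner_Integration.integral_sum conv_integrable[OF _ assms(2-4)])

lemma conv_cmult: "conv (\<lambda>y. c * g y) \<rho> x = c * conv g \<rho> x"
  by (simp add: conv_def mult.assoc)

text \<open>An average of \<open>g\<close> over a ball is at least its essential lower bound there.
  It will keep the mollified \<open>\<phi>\<close> away from 0, so that it may be divided
  by.\<close>

lemma conv_lower_bound:
  fixes g \<rho> :: "real^'n \<Rightarrow> real"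
  assumes g: "integrable lborel g" and ae: "AE y in lborel. y \<in> cball x e \<longrightarrow> m \<le> g y"
    and \<rho>: "continuous_on UNIV \<rho>" "\<And>x. 0 \<le> \<rho> x" "\<And>x. \<rho> (- x) = \<rho> x"
    and supp: "\<And>z. z \<notin> cball 0 e \<Longrightarrow> \<rho> z = 0" and 1: "(\<integral>x. \<rho> x \<partial>lborel) = 1"
  shows "m \<le> conv g \<rho> x"
proof -
  have int: "integrable lborel (\<lambda>y. \<rho> (x - y))"
  proof (rule integrable_continuous_compact_support)
    show "continuous_on UNIV (\<lambda>y. \<rho> (x - y))"
      by (intro continuous_on_compose2[OF \<rho>(1)] continuous_intros) auto
    show "\<rho> (x - y) = 0" if "y \<notin> cball x e" for y
      using that by (intro supp) (auto simp: dist_norm norm_minus_commute)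
  qed simp
  \<comment> \<open>Evenness turns the reflection into a translation, which preserves the mass
    1.\<close>
  have "\<rho> (x - y) = \<rho> (y + (- x))" for y
    using \<rho>(3)[of "x - y"] by simp
  then have "(\<integral>y. \<rho> (x - y) \<partial>lborel) = (\<integral>y. \<rho> (y + (- x)) \<partial>lborel)"
    by (simp only:)
  also have "\<dots> = 1"
    using lborel_integral_translate[of \<rho> "- x"] \<rho>(1) 1 by (auto intro: borel_measurable_continuous_onI)
  finally have "m = (\<integral>y. m * \<rho> (x - y) \<partial>lborel)" by simp
  also have "\<dots> \<le> (\<integral>y. g y * \<rho> (x - y) \<partial>lborel)"
  proof (rule integral_mono_AE)
    show "AE y in lborel. m * \<rho> (x - y) \<le> g y * \<rho> (x - y)"
      using ae
    proof eventually_elim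
      case (elim y)
      show ?case
      proof (cases "y \<in> cball x e")
        case True
        then show ?thesis using elim \<rho>(2) by (intro mult_right_mono) auto
      next
        case False
        then have "\<rho> (x - y) = 0" by (intro supp) (auto simp: dist_norm norm_minus_commute)
        then show ?thesis by simp
      qed
    qed
  qed (use int in simp, rule conv_integrable[OF g \<rho>(1) compact_cball supp])
  finally show ?thesis by (simp add: conv_def)
qed

text \<open>The inequality is convolved with \<open>\<rho>\<close> after its coefficients
  \<open>V\<close> and \<open>c\<close> have been frozen at \<open>x\<close>. Freezing costs at most
  \<open>\<omega>\<close> times the convolution of the absolute values of \<open>\<phi>'\<close>
  and, doubled, of its weak first derivatives; all derivatives then pass to the kernel.\<close>

lemma mollified_supersolution:
  fixes \<phi> :: "real^'n \<Rightarrow> real" and V :: "real^'n \<Rightarrow> real^'n"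
  assumes \<Omega>: "open \<Omega>" and K: "compact K" "K \<subseteq> \<Omega>"
    and w: "\<And>i. weak_partial \<Omega> i \<phi> (G i)" "\<And>i. weak_partial \<Omega> i (G i) (H i)"
    and tr: "truncation K \<phi> \<phi>'" "\<And>i. truncation K (G i) (G' i)" "\<And>i. truncation K (H i) (H' i)"
    and ineq: "AE y in lborel. y \<in> K \<longrightarrow>
      c y * \<phi> y \<le> - (\<Sum>i\<in>UNIV. H i y) - 2 * (\<Sum>i\<in>UNIV. V y $ i * G i y)"
    and \<rho>: "smooth_term \<rho>" "\<And>x. 0 \<le> \<rho> x" "\<And>z. z \<notin> cball 0 e \<Longrightarrow> \<rho> z = 0"
    and x: "cball x e \<subseteq> K"
    and osc: "\<And>y i. y \<in> cball x e \<Longrightarrow> \<bar>V x $ i - V y $ i\<bar> \<le> \<omega>"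
      "\<And>y. y \<in> cball x e \<Longrightarrow> \<bar>c x - c y\<bar> \<le> \<omega>"
  shows "c x * conv \<phi>' \<rho> x - \<omega> * conv (\<lambda>y. 2 * (\<Sum>i\<in>UNIV. \<bar>G' i y\<bar>) + \<bar>\<phi>' y\<bar>) \<rho> x
    \<le> - (\<Sum>i\<in>UNIV. conv \<phi>' (partial i (partial i \<rho>)) x)
       - 2 * (\<Sum>i\<in>UNIV. V x $ i * conv \<phi>' (partial i \<rho>) x)"
proof -
  define J where "J y = 2 * (\<Sum>i\<in>UNIV. \<bar>G' i y\<bar>) + \<bar>\<phi>' y\<bar>" for y
  \<comment> \<open>The differential operator with the drift taken at \<open>x\<close>, so that its
    coefficients come out of the convolution.\<close>
  define N where "N y = (\<Sum>i\<in>UNIV. H' i y) + 2 * (\<Sum>i\<in>UNIV. V x $ i * G' i y)" for y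
  have int: "integrable lborel \<phi>'" "\<And>i. integrable lborel (G' i)" "\<And>i. integrable lborel (H' i)"
    using tr by (auto simp: truncation_def)
  have intJ: "integrable lborel J"
    unfolding J_def using int by (intro Bochner_Integration.integrable_add integrable_mult_right Bochner_Integration.integrable_sum) auto
  have intN: "integrable lborel N"
    unfolding N_def using int by (intro Bochner_Integration.integrable_add integrable_mult_right Bochner_Integration.integrable_sum) auto
  have cont: "continuous_on UNIV \<rho>" using \<rho>(1) by (rule smooth_term_continuous)
  note rr = cont compact_cball[of 0 e] \<rho>(3)
  have "AE y in lborel. \<phi>' y = indicator K y * \<phi> y" using tr(1) by (simp add: truncation_def)
  moreover have "AE y in lborel. \<forall>i. G' i y = indicator K y * G i y"
    using tr(2) by (intro eventually_all_finite) (simp add: truncation_def)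
  moreover have "AE y in lborel. \<forall>i. H' i y = indicator K y * H i y"
    using tr(3) by (intro eventually_all_finite) (simp add: truncation_def)
  ultimately have "AE y in lborel. 0 \<le> (\<omega> * J y - (N y + c x * \<phi>' y)) * \<rho> (x - y)"
    using ineq
  proof eventually_elim
    case (elim y)
    show ?case
    proof (cases "y \<in> cball x e")
      case True
      with x have y: "y \<in> K" by auto
      have e: "\<phi>' y = \<phi> y" "\<And>i. G' i y = G i y" "\<And>i. H' i y = H i y"
        using elim y by auto
      have "(c x - c y) * \<phi>' y \<le> \<omega> * \<bar>\<phi>' y\<bar>"
        using osc(2)[OF True] by (metis abs_ge_self abs_ge_zero abs_mult mult_right_mono order_trans)
      then have "c x * \<phi>' y - c y * \<phi>' y \<le> \<omega> * \<bar>\<phi>' y\<bar>"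
        by (simp only: left_diff_distrib)
      moreover have "(\<Sum>i\<in>UNIV. (V x $ i - V y $ i) * G' i y) \<le> (\<Sum>i\<in>UNIV. \<omega> * \<bar>G' i y\<bar>)"
      proof (rule sum_mono)
        show "(V x $ i - V y $ i) * G' i y \<le> \<omega> * \<bar>G' i y\<bar>" for i
          using osc(1)[OF True, of i] by (metis abs_ge_self abs_ge_zero abs_mult mult_right_mono order_trans)
      qed
      then have "(\<Sum>i\<in>UNIV. V x $ i * G' i y) - (\<Sum>i\<in>UNIV. V y $ i * G' i y)
          \<le> \<omega> * (\<Sum>i\<in>UNIV. \<bar>G' i y\<bar>)"
        by (simp only: left_diff_distrib sum_subtractf sum_distrib_left)
      moreover have "c y * \<phi>' y \<le> - (\<Sum>i\<in>UNIV. H' i y) - 2 * (\<Sum>i\<in>UNIV. V y $ i * G' i y)"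
        using elim y by (simp add: e)
      ultimately have "0 \<le> \<omega> * J y - (N y + c x * \<phi>' y)"
        unfolding J_def N_def distrib_left mult.left_commute[of \<omega> 2] by linarith
      then show ?thesis using \<rho>(2) by simp
    next
      case False
      then have "\<rho> (x - y) = 0" by (intro \<rho>(3)) (auto simp: dist_norm norm_minus_commute)
      then show ?thesis by simp
    qed
  qed
  then have "0 \<le> conv (\<lambda>y. \<omega> * J y - (N y + c x * \<phi>' y)) \<rho> x"
    unfolding conv_def by (rule integral_nonneg_AE)
  also have "\<dots> = \<omega> * conv J \<rho> x - (conv N \<rho> x + c x * conv \<phi>' \<rho> x)"
  proof -
    have 1: "conv (\<lambda>y. \<omega> * J y - (N y + c x * \<phi>' y)) \<rho> x
        = conv (\<lambda>y. \<omega> * J y) \<rho> x - conv (\<lambda>y. N y + c x * \<phi>' y) \<rho> x"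
      using int intJ intN by (intro conv_diff[OF _ _ rr]) auto
    have 2: "conv (\<lambda>y. N y + c x * \<phi>' y) \<rho> x = conv N \<rho> x + conv (\<lambda>y. c x * \<phi>' y) \<rho> x"
      using int intN by (intro conv_add[OF _ _ rr]) auto
    show ?thesis unfolding 1 2 conv_cmult ..
  qed
  finally have pos: "0 \<le> \<omega> * conv J \<rho> x - (conv N \<rho> x + c x * conv \<phi>' \<rho> x)" .
  have N: "conv N \<rho> x = (\<Sum>i\<in>UNIV. conv (H' i) \<rho> x) + 2 * (\<Sum>i\<in>UNIV. V x $ i * conv (G' i) \<rho> x)"
  proof -
    have 1: "conv N \<rho> x = conv (\<lambda>y. \<Sum>i\<in>UNIV. H' i y) \<rho> x
        + conv (\<lambda>y. 2 * (\<Sum>i\<in>UNIV. V x $ i * G' i y)) \<rho> x"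
      unfolding N_def using int by (intro conv_add[OF _ _ rr]) auto
    have 2: "conv (\<lambda>y. \<Sum>i\<in>UNIV. H' i y) \<rho> x = (\<Sum>i\<in>UNIV. conv (H' i) \<rho> x)"
      using int by (intro conv_sum[OF _ rr]) auto
    have 3: "conv (\<lambda>y. \<Sum>i\<in>UNIV. V x $ i * G' i y) \<rho> x = (\<Sum>i\<in>UNIV. conv (\<lambda>y. V x $ i * G' i y) \<rho> x)"
      using int by (intro conv_sum[OF _ rr]) auto
    show ?thesis unfolding 1 conv_cmult 2 3 ..
  qed
  have G: "conv (G' i) \<rho> x = conv \<phi>' (partial i \<rho>) x" for i
    by (rule weak_partial_conv[OF w(1) \<Omega> K tr(1,2) \<rho>(1,3) x, symmetric])
  have H: "conv (H' i) \<rho> x = conv \<phi>' (partial i (partial i \<rho>)) x" for i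
  proof -
    have "conv (H' i) \<rho> x = conv (G' i) (partial i \<rho>) x"
      by (rule weak_partial_conv[OF w(2) \<Omega> K tr(2,3) \<rho>(1,3) x, symmetric])
    \<comment> \<open>The second derivative is moved by using \<open>partial i \<rho>\<close> as the
      kernel; it vanishes outside the same ball.\<close>
    also have "\<dots> = conv \<phi>' (partial i (partial i \<rho>)) x"
      by (rule weak_partial_conv[OF w(1) \<Omega> K tr(1,2) smooth_term_partial(2)[OF \<rho>(1)] _ x, symmetric])
        (rule partial_eq_0_outside[OF closed_cball \<rho>(3)])
    finally show ?thesis .
  qed
  show ?thesis using pos unfolding N G H J_def[symmetric] by linarith
qed

text \<open>Applied to \<open>D = \<nabla>u\<close>: the equation makes \<open>b\<bar>\<nabla>u\<bar>\<^sup>2\<close> continuous, although nothing is known about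
  the continuity of \<open>b\<close>.\<close>

lemma continuous_on_bounded_scaleR:
  fixes D :: "'a::metric_space \<Rightarrow> 'b::real_normed_vector"
  assumes D: "continuous_on S D" and f: "continuous_on S (\<lambda>x. b x * (norm (D x))\<^sup>2)"
    and B: "\<And>x. x \<in> S \<Longrightarrow> \<bar>b x\<bar> \<le> B"
  shows "continuous_on S (\<lambda>x. b x *\<^sub>R D x)"
  unfolding continuous_on_def
proof
  fix x assume x: "x \<in> S"
  have Dx: "(D \<longlongrightarrow> D x) (at x within S)"
    and fx: "((\<lambda>x. b x * (norm (D x))\<^sup>2) \<longlongrightarrow> b x * (norm (D x))\<^sup>2) (at x within S)"
    using D f x by (auto simp: continuous_on_def)
  \<comment> \<open>At a zero of \<open>D\<close> boundedness of \<open>b\<close> suffices;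
    elsewhere \<open>b\<close> itself is recovered as a continuous quotient by the squared norm of
    \<open>D\<close>.\<close>
  show "((\<lambda>x. b x *\<^sub>R D x) \<longlongrightarrow> b x *\<^sub>R D x) (at x within S)"
  proof (cases "D x = 0")
    case True
    have "((\<lambda>y. B * norm (D y)) \<longlongrightarrow> B * norm (D x)) (at x within S)"
      by (intro tendsto_intros Dx)
    then have "((\<lambda>y. B * norm (D y)) \<longlongrightarrow> 0) (at x within S)" using True by simp
    moreover have "eventually (\<lambda>y. norm (b y *\<^sub>R D y) \<le> B * norm (D y)) (at x within S)"
      using B by (auto simp: eventually_at_filter intro!: always_eventually mult_right_mono)
    ultimately have "((\<lambda>x. b x *\<^sub>R D x) \<longlongrightarrow> 0) (at x within S)"
      by (rule Lim_null_comparison[rotated])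
    then show ?thesis using True by simp
  next
    case False
    have "((\<lambda>y. (b y * (norm (D y))\<^sup>2 / (norm (D y))\<^sup>2) *\<^sub>R D y)
        \<longlongrightarrow> (b x * (norm (D x))\<^sup>2 / (norm (D x))\<^sup>2) *\<^sub>R D x) (at x within S)"
      using False by (intro tendsto_intros Dx fx) auto
    moreover have "eventually (\<lambda>y. D y \<noteq> 0) (at x within S)"
      by (rule tendsto_imp_eventually_ne[OF Dx False])
    then have "eventually (\<lambda>y. (b y * (norm (D y))\<^sup>2 / (norm (D y))\<^sup>2) *\<^sub>R D y = b y *\<^sub>R D y) (at x within S)"
      by eventually_elim simp
    ultimately show ?thesis using False by (auto elim: Lim_transform_eventually)
  qed
qed

text \<open>Here \<open>D\<close> and \<open>\<Delta>\<close> stand for the gradient and Laplacian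
  of \<open>u\<close>, \<open>W\<close> and \<open>L\<close> for those of the mollified
  \<open>\<phi>\<close>, \<open>l\<close> for \<open>lam * exp u\<close>, and \<open>E\<close> for
  the mollification error. The right-hand side is the divergence of \<open>k D\<close> minus that of
  \<open>h\<^sup>2 W / \<phi>\<close>. The stability inequality is multiplied by
  \<open>h\<^sup>2 / \<phi>\<close>; the terms quadratic in \<open>W / \<phi>\<close> and
  \<open>D\<close> are absorbed by the square of \<open>h W / \<phi> - (h' - b h) D\<close>.\<close>

lemma pointwise_energy_inequality:
  fixes D W :: "real^'n"
  assumes \<phi>: "0 < \<phi>"
    and stab: "l * \<phi> - E \<le> - L - 2 * b * (D \<bullet> W)"
    and eqn: "- \<Delta> - b * (norm D)\<^sup>2 = l"
    and weight: "(h' - b * h)\<^sup>2 \<le> k' - b * k"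
  shows "l * (h\<^sup>2 - k) - h\<^sup>2 * E / \<phi> \<le> (k' * (norm D)\<^sup>2 + k * \<Delta>)
    - (2 * h * h' * (D \<bullet> W) / \<phi> + h\<^sup>2 * L / \<phi> - h\<^sup>2 * (norm W)\<^sup>2 / \<phi>\<^sup>2)"
proof -
  define w where "w = (1 / \<phi>) *\<^sub>R W"
  have Dw: "D \<bullet> W / \<phi> = D \<bullet> w" and ww: "(norm W)\<^sup>2 / \<phi>\<^sup>2 = (norm w)\<^sup>2"
    using \<phi> by (simp_all add: w_def power_divide)
  have "0 \<le> (norm (h *\<^sub>R w - (h' - b * h) *\<^sub>R D))\<^sup>2" by simp
  also have "\<dots> = h\<^sup>2 * (norm w)\<^sup>2 - 2 * h * (h' - b * h) * (D \<bullet> w) + (h' - b * h)\<^sup>2 * (norm D)\<^sup>2"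
    unfolding power2_norm_eq_inner
    by (simp add: inner_diff inner_commute power2_eq_square algebra_simps)
  finally have 1: "2 * h * (h' - b * h) * (D \<bullet> w) - h\<^sup>2 * (norm w)\<^sup>2 \<le> (h' - b * h)\<^sup>2 * (norm D)\<^sup>2"
    by simp
  have 2: "(h' - b * h)\<^sup>2 * (norm D)\<^sup>2 \<le> (k' - b * k) * (norm D)\<^sup>2"
    using weight by (rule mult_right_mono) simp
  have "h\<^sup>2 / \<phi> * (l * \<phi> - E) \<le> h\<^sup>2 / \<phi> * (- L - 2 * b * (D \<bullet> W))"
    using stab \<phi> by (intro mult_left_mono) auto
  moreover have "h\<^sup>2 / \<phi> * (l * \<phi> - E) = h\<^sup>2 * l - h\<^sup>2 * E / \<phi>"
    using \<phi> by (simp add: right_diff_distrib)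
  moreover have "h\<^sup>2 / \<phi> * (- L - 2 * b * (D \<bullet> W)) = - (h\<^sup>2 * L / \<phi>) - 2 * b * h\<^sup>2 * (D \<bullet> W / \<phi>)"
    by (simp add: right_diff_distrib)
  ultimately have 3: "h\<^sup>2 * l - h\<^sup>2 * E / \<phi> \<le> - (h\<^sup>2 * L / \<phi>) - 2 * b * h\<^sup>2 * (D \<bullet> w)"
    by (simp only: Dw)
  have "\<Delta> = - b * (norm D)\<^sup>2 - l" using eqn by simp
  have 4: "k * \<Delta> = - (b * k) * (norm D)\<^sup>2 - l * k"
    unfolding \<open>\<Delta> = _\<close> by (simp add: algebra_simps)
  have 5: "2 * h * h' * (D \<bullet> W) / \<phi> = 2 * h * h' * (D \<bullet> w)" "h\<^sup>2 * (norm W)\<^sup>2 / \<phi>\<^sup>2 = h\<^sup>2 * (norm w)\<^sup>2"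
    by (simp_all add: Dw[symmetric] ww[symmetric])
  show ?thesis
    unfolding 4 5 using 1 2 3 by (simp add: power2_eq_square algebra_simps)
qed

section \<open>The energy estimate\<close>

text \<open>The zero boundary values keep the set where \<open>u \<ge> 1\<close> away from the
  frontier.\<close>

lemma superlevel_compact:
  fixes u :: "'a::euclidean_space \<Rightarrow> real"
  assumes "open \<Omega>" "bounded \<Omega>" "continuous_on (closure \<Omega>) u" "\<And>x. x \<in> frontier \<Omega> \<Longrightarrow> u x = 0"
  shows "compact {x \<in> closure \<Omega>. 1 \<le> u x}" "{x \<in> closure \<Omega>. 1 \<le> u x} \<subseteq> \<Omega>"
proof -
  have "closed {x \<in> closure \<Omega>. 1 \<le> u x}"
    by (rule continuous_on_closed_Collect_le[OF continuous_on_const assms(3) closed_closure])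
  moreover have "bounded {x \<in> closure \<Omega>. 1 \<le> u x}"
    using assms(2) by (rule bounded_subset[OF bounded_closure]) auto
  ultimately show "compact {x \<in> closure \<Omega>. 1 \<le> u x}" by (simp add: compact_eq_bounded_closed)
  show "{x \<in> closure \<Omega>. 1 \<le> u x} \<subseteq> \<Omega>"
  proof
    fix x assume x: "x \<in> {x \<in> closure \<Omega>. 1 \<le> u x}"
    then have "x \<notin> frontier \<Omega>" using assms(4) by auto
    with x show "x \<in> \<Omega>" using assms(1) by (simp add: frontier_def interior_open)
  qed
qed

lemma continuous_on_compact_bound:
  fixes f :: "'a::topological_space \<Rightarrow> real"
  assumes "compact K" "continuous_on K f"
  obtains M where "0 \<le> M" "\<And>x. x \<in> K \<Longrightarrow> \<bar>f x\<bar> \<le> M"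
proof -
  have "bounded (f ` K)" using assms by (intro compact_imp_bounded compact_continuous_image)
  then obtain M where "\<And>x. x \<in> K \<Longrightarrow> \<bar>f x\<bar> \<le> M"
    unfolding bounded_iff by (metis imageI real_norm_def)
  then show ?thesis using that[of "max M 0"] by (metis max.cobounded2 max.coboundedI1)
qed

text \<open>The pointwise inequality is integrated for a mollified \<open>\<phi>\<close>. The
  divergences integrate to 0, and the mollification error can be made arbitrarily small.\<close>

lemma energy_estimate:
  fixes \<Omega> :: "(real^'n) set" and u b :: "real^'n \<Rightarrow> real"
  assumes \<Omega>: "open \<Omega>" "bounded \<Omega>" and lam: "0 < lam"
    and stable: "stable_solution \<Omega> b lam exp u"
    and bnd: "\<And>x. x \<in> \<Omega> \<Longrightarrow> blow \<le> b x \<and> b x \<le> bup" and a: "0 \<le> a"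
    and weight: "\<And>b r. blow \<le> b \<Longrightarrow> b \<le> bup \<Longrightarrow> 0 \<le> r \<Longrightarrow> (a * r * (r + 1) - b * r\<^sup>2)\<^sup>2 \<le>
     \<kappa> * (2 * a * r ^ 3 * (r + 1)) + P * (3 / 2 * a * r\<^sup>2 * (r + 1)) - b * (\<kappa> * r ^ 4 + P * r ^ 3)"
  defines "K \<equiv> {x \<in> closure \<Omega>. 1 \<le> u x}"
  shows "(\<integral>x. indicator K x * (exp (u x) *
     (trunc_exp a (u x) ^ 4 - (\<kappa> * trunc_exp a (u x) ^ 4 + P * trunc_exp a (u x) ^ 3))) \<partial>lborel) \<le> 0"
proof -
  have cls: "classical_solution \<Omega> b lam exp u" using stable by (simp add: stable_solution_def)
  obtain p \<phi> G H where \<phi>: "continuous_on (closure \<Omega>) \<phi>" "\<And>x. x \<in> closure \<Omega> \<Longrightarrow> \<phi> x > 0"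
    and w: "\<And>i. weak_partial \<Omega> i \<phi> (G i)" "\<And>i. weak_partial \<Omega> i (G i) (H i)"
    and ae: "AE x in lebesgue_on \<Omega>. - (\<Sum>i\<in>UNIV. H i x) - 2 * b x * (grad u x \<bullet> (\<chi> i. G i x))
           \<ge> lam * deriv exp (u x) * \<phi> x"
    using stable unfolding stable_solution_def by blast
  have "Ck_on (Suc (Suc 0)) \<Omega> u" using cls by (simp add: classical_solution_def numeral_2_eq_2)
  then have du: "\<And>x. x \<in> \<Omega> \<Longrightarrow> u differentiable (at x)"
      "\<And>i x. x \<in> \<Omega> \<Longrightarrow> partial i u differentiable (at x)"
    and cuu: "\<And>i. continuous_on \<Omega> (partial i (partial i u))" by auto
  have cu: "continuous_on \<Omega> u" and cdu: "\<And>i. continuous_on \<Omega> (partial i u)"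
    using du by (auto intro!: continuous_at_imp_continuous_on differentiable_imp_continuous_within)
  have ucl: "continuous_on (closure \<Omega>) u" and u0: "\<And>x. x \<in> frontier \<Omega> \<Longrightarrow> u x = 0"
    and eqn: "\<And>x. x \<in> \<Omega> \<Longrightarrow> - laplacian u x - b x * (norm (grad u x))\<^sup>2 = lam * exp (u x)"
    using cls by (auto simp: classical_solution_def)
  have K: "compact K" "K \<subseteq> \<Omega>"
    unfolding K_def using superlevel_compact[OF \<Omega> ucl u0] by auto
  show ?thesis
  proof (cases "K = {}")
    case True
    then show ?thesis by simp
  next
    case False

    \<comment> \<open>Neighbourhoods of the superlevel set and truncated data\<close>
    obtain d where d: "0 < d" "(\<Union>x\<in>K. cball x d) \<subseteq> \<Omega>"
      using compact_subset_open_imp_cball_epsilon_subset[OF K(1) \<Omega>(1) K(2)] by blast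
    define K2 where "K2 = (\<Union>x\<in>K. cball x d)"
    have "K2 = {x + y | x y. x \<in> K \<and> y \<in> cball 0 d}"
    proof (intro set_eqI iffI)
      fix z assume "z \<in> K2"
      then obtain x where "x \<in> K" "z \<in> cball x d" by (auto simp: K2_def)
      then have "z = x + (z - x) \<and> x \<in> K \<and> z - x \<in> cball 0 d"
        by (simp add: dist_norm norm_minus_commute)
      then show "z \<in> {x + y | x y. x \<in> K \<and> y \<in> cball 0 d}" by blast
    next
      fix z assume "z \<in> {x + y | x y. x \<in> K \<and> y \<in> cball 0 d}"
      then show "z \<in> K2" by (force simp: K2_def dist_norm)
    qed
    then have "compact K2" using compact_sums[OF K(1) compact_cball[of 0 d]] by simp
    moreover have "K2 \<subseteq> \<Omega>" using d(2) by (simp add: K2_def)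
    ultimately have K2: "compact K2" "K2 \<subseteq> \<Omega>" by auto
    \<comment> \<open>Half the radius of \<open>K2\<close>: a kernel of radius at most
      \<open>d / 2\<close> centred in \<open>U\<close> sees only \<open>K2\<close>, where the
      truncations agree with the original functions almost everywhere.\<close>
    define U where "U = (\<Union>x\<in>K. ball x (d / 2))"
    have U: "open U" "K \<subseteq> U" using d by (auto simp: U_def)
    have UK2: "cball x e \<subseteq> K2" if "x \<in> U" "e \<le> d / 2" for x e
    proof
      fix y assume "y \<in> cball x e"
      then have "dist x y \<le> d / 2" using that by simp
      moreover from that obtain z where "z \<in> K" "dist z x < d / 2" by (auto simp: U_def)
      ultimately have "dist z y \<le> d" using dist_triangle[of z y x] by simp
      with \<open>z \<in> K\<close> show "y \<in> K2" by (auto simp: K2_def)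
    qed
    have U\<Omega>: "U \<subseteq> \<Omega>"
    proof
      fix x assume "x \<in> U"
      from UK2[OF this, of 0] show "x \<in> \<Omega>" using d K2(2) by auto
    qed
    have "K2 \<noteq> {}" using False d by (auto simp: K2_def)
    moreover have "continuous_on K2 \<phi>" using \<phi>(1) K2(2) closure_subset by (blast intro: continuous_on_subset)
    ultimately obtain x0 where x0: "x0 \<in> K2" "\<And>y. y \<in> K2 \<Longrightarrow> \<phi> x0 \<le> \<phi> y"
      using continuous_attains_inf[OF K2(1)] by blast
    \<comment> \<open>The minimum of \<open>\<phi>\<close> on \<open>K2\<close>, a lower bound on
      \<open>U\<close> for all the mollifications below.\<close>
    define m where "m = \<phi> x0"
    have m: "0 < m" "\<And>y. y \<in> K2 \<Longrightarrow> m \<le> \<phi> y"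
      using x0 \<phi>(2) K2(2) closure_subset[of \<Omega>] by (auto simp: m_def)
    have loc: "locally_integrable \<Omega> \<phi>" "\<And>i. locally_integrable \<Omega> (G i)" "\<And>i. locally_integrable \<Omega> (H i)"
      using w by (auto simp: weak_partial_def)
    obtain \<phi>' where tr\<phi>: "truncation K2 \<phi> \<phi>'" using truncation_exists[OF loc(1) K2] by blast
    have "\<forall>i. \<exists>g. truncation K2 (G i) g" using truncation_exists[OF loc(2) K2] by metis
    then obtain G' where trG: "\<And>i. truncation K2 (G i) (G' i)" by metis
    have "\<forall>i. \<exists>g. truncation K2 (H i) g" using truncation_exists[OF loc(3) K2] by metis
    then obtain H' where trH: "\<And>i. truncation K2 (H i) (H' i)" by metis
    define J where "J y = 2 * (\<Sum>i\<in>UNIV. \<bar>G' i y\<bar>) + \<bar>\<phi>' y\<bar>" for y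
    have J_eq: "J = (\<lambda>y. 2 * (\<Sum>i\<in>UNIV. \<bar>G' i y\<bar>) + \<bar>\<phi>' y\<bar>)"
      by (simp add: fun_eq_iff J_def)
    have int: "integrable lborel \<phi>'" "\<And>i. integrable lborel (G' i)"
      using tr\<phi> trG by (auto simp: truncation_def)
    have J: "integrable lborel J" "\<And>y. 0 \<le> J y"
      unfolding J_def using int
      by (auto intro!: Bochner_Integration.integrable_add integrable_mult_right Bochner_Integration.integrable_sum add_nonneg_nonneg sum_nonneg)
    define V where "V y = b y *\<^sub>R grad u y" for y
    have cgrad: "continuous_on \<Omega> (grad u)"
      unfolding grad_def using cdu by (intro continuous_on_vec_lambda)
    have clap: "continuous_on \<Omega> (laplacian u)"
      unfolding laplacian_def using cuu by (intro continuous_intros)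
    have cV: "continuous_on \<Omega> V"
      unfolding V_def
    proof (rule continuous_on_bounded_scaleR[OF cgrad, where B = "\<bar>blow\<bar> + \<bar>bup\<bar>"])
      have "continuous_on \<Omega> (\<lambda>x. - laplacian u x - lam * exp (u x))"
        by (intro continuous_intros clap cu)
      then show "continuous_on \<Omega> (\<lambda>x. b x * (norm (grad u x))\<^sup>2)"
        by (rule continuous_on_eq) (use eqn in \<open>force simp: algebra_simps\<close>)
      show "\<bar>b x\<bar> \<le> \<bar>blow\<bar> + \<bar>bup\<bar>" if "x \<in> \<Omega>" for x using bnd[OF that] by linarith
    qed
    define c where "c y = lam * exp (u y)" for y
    have cc: "continuous_on \<Omega> c" unfolding c_def by (intro continuous_intros cu)
    have "AE y in lebesgue. y \<in> \<Omega> \<longrightarrow> lam * deriv exp (u y) * \<phi> y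
        \<le> - (\<Sum>i\<in>UNIV. H i y) - 2 * b y * (grad u y \<bullet> (\<chi> i. G i y))"
      using ae \<Omega>(1) by (subst (asm) AE_restrict_space_iff) auto
    then have "AE y in lborel. y \<in> \<Omega> \<longrightarrow> lam * deriv exp (u y) * \<phi> y
        \<le> - (\<Sum>i\<in>UNIV. H i y) - 2 * b y * (grad u y \<bullet> (\<chi> i. G i y))"
      by (simp only: AE_completion_iff)
    then have ineq: "AE y in lborel. y \<in> K2 \<longrightarrow>
      c y * \<phi> y \<le> - (\<Sum>i\<in>UNIV. H i y) - 2 * (\<Sum>i\<in>UNIV. V y $ i * G i y)"
    proof eventually_elim
      case (elim y)
      have "deriv exp (u y) = exp (u y)" by (rule DERIV_imp_deriv[OF DERIV_exp])
      moreover have "2 * b y * (grad u y \<bullet> (\<chi> i. G i y)) = 2 * (\<Sum>i\<in>UNIV. V y $ i * G i y)"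
        by (simp add: V_def inner_vec_def sum_distrib_left mult.assoc)
      ultimately show ?case using elim K2(2) by (auto simp: c_def)
    qed
    define r where "r x = trunc_exp a (u x)" for x
    have cr: "continuous_on \<Omega> r"
      unfolding r_def by (intro continuous_on_compose2[OF continuous_on_trunc_exp cu]) auto
    have r0: "0 \<le> r x" for x using a by (simp add: r_def trunc_exp_nonneg)
    have rz: "r x = 0" if "x \<in> \<Omega> - K" for x
      using that closure_subset[of \<Omega>] by (intro trunc_exp_eq_0[of "u x" a, folded r_def]) (auto simp: K_def)
    have "continuous_on K (\<lambda>x. r x ^ 4)"
      by (intro continuous_on_power continuous_on_subset[OF cr K(2)])
    then obtain M where M: "0 \<le> M" "\<And>x. x \<in> K \<Longrightarrow> \<bar>r x ^ 4\<bar> \<le> M"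
      using continuous_on_compact_bound[OF K(1)] by blast
    define I where "I = (\<integral>x. indicator K x * (exp (u x) * (r x ^ 4 - (\<kappa> * r x ^ 4 + P * r x ^ 3))) \<partial>lborel)"
    \<comment> \<open>The factor after \<open>\<omega>\<close> was fixed before the kernel is
      chosen, so \<open>\<omega>\<close> can be made small afterwards.\<close>
    have main: "lam * I \<le> \<omega> * (M / m * (\<integral>y. J y \<partial>lborel))" if \<omega>: "0 < \<omega>" for \<omega>
    proof -

      \<comment> \<open>Mollification at a scale chosen from the oscillation
        \<open>\<omega>\<close>\<close>
      have uV: "uniformly_continuous_on K2 V" and uc: "uniformly_continuous_on K2 c"
        using cV cc K2 by (auto intro: compact_uniformly_continuous continuous_on_subset)
      obtain d1 where d1: "0 < d1" "\<And>x y. x \<in> K2 \<Longrightarrow> y \<in> K2 \<Longrightarrow> dist y x < d1 \<Longrightarrow> dist (V y) (V x) < \<omega>"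
        using uV \<omega> unfolding uniformly_continuous_on_def by metis
      obtain d2 where d2: "0 < d2" "\<And>x y. x \<in> K2 \<Longrightarrow> y \<in> K2 \<Longrightarrow> dist y x < d2 \<Longrightarrow> dist (c y) (c x) < \<omega>"
        using uc \<omega> unfolding uniformly_continuous_on_def by metis
      \<comment> \<open>Halving makes \<open>e\<close> strictly smaller than \<open>d1\<close> and
        \<open>d2\<close>, because the kernel is supported in a closed ball while the moduli of
        continuity are strict.\<close>
      define e where "e = min (d / 2) (min d1 d2 / 2)"
      have e: "0 < e" "e \<le> d / 2" "e < d1" "e < d2" using d d1 d2 by (auto simp: e_def)
      obtain \<rho> :: "real^'n \<Rightarrow> real" where \<rho>: "smooth_term \<rho>" "\<And>x. 0 \<le> \<rho> x" "\<And>x. \<rho> (- x) = \<rho> x"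
          "\<And>z. z \<notin> cball 0 e \<Longrightarrow> \<rho> z = 0" "(\<integral>x. \<rho> x \<partial>lborel) = 1"
        using exists_smooth_kernel[OF e(1)] by metis
      note p\<rho> = smooth_term_partial(2)[OF \<rho>(1)]
      note pp\<rho> = smooth_term_partial(2)[OF p\<rho>]
      have p0: "partial i \<rho> z = 0" if "z \<notin> cball 0 e" for i z
        using partial_eq_0_outside[OF closed_cball \<rho>(4) that] .
      have pp0: "partial i (partial i \<rho>) z = 0" if "z \<notin> cball 0 e" for i z
        using partial_eq_0_outside[OF closed_cball p0 that] .
      define \<Phi> where "\<Phi> = conv \<phi>' \<rho>"
      define W where "W i = conv \<phi>' (partial i \<rho>)" for i
      define L where "L i = conv \<phi>' (partial i (partial i \<rho>))" for i
      have c\<Phi>: "continuous_on S \<Phi>" for S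
        unfolding \<Phi>_def by (rule continuous_on_subset[OF conv_continuous subset_UNIV,
              OF int(1) smooth_term_continuous[OF \<rho>(1)] compact_cball[of 0 e] \<rho>(4)])
      have cW: "continuous_on S (W i)" for i S
        unfolding W_def by (rule continuous_on_subset[OF conv_continuous subset_UNIV,
              OF int(1) smooth_term_continuous[OF p\<rho>] compact_cball[of 0 e] p0])
      have cL: "continuous_on S (L i)" for i S
        unfolding L_def by (rule continuous_on_subset[OF conv_continuous subset_UNIV,
              OF int(1) smooth_term_continuous[OF pp\<rho>] compact_cball[of 0 e] pp0])
      have d\<Phi>: "has_partial \<Phi> i (W i x) x" for i x
        unfolding \<Phi>_def W_def by (rule conv_has_partial[OF int(1) \<rho>(1) compact_cball[of 0 e] \<rho>(4)])
      have dW: "has_partial (W i) i (L i x) x" for i x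
        unfolding W_def L_def by (rule conv_has_partial[OF int(1) p\<rho> compact_cball[of 0 e] p0])
      have \<Phi>m: "m \<le> \<Phi> x" if "x \<in> U" for x
        unfolding \<Phi>_def
      proof (rule conv_lower_bound[OF int(1) _ smooth_term_continuous[OF \<rho>(1)] \<rho>(2-5)])
        have "AE y in lborel. \<phi>' y = indicator K2 y * \<phi> y" using tr\<phi> by (simp add: truncation_def)
        then show "AE y in lborel. y \<in> cball x e \<longrightarrow> m \<le> \<phi>' y"
          by eventually_elim (use m(2) UK2[OF that e(2)] in auto)
      qed
      have \<Phi>pos: "0 < \<Phi> x" if "x \<in> U" for x using \<Phi>m[OF that] m(1) by linarith
      define JJ where "JJ = conv J \<rho>"
      have JJ: "integrable lborel JJ" "(\<integral>x. JJ x \<partial>lborel) = (\<integral>y. J y \<partial>lborel)"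
        unfolding JJ_def
        using conv_integral[OF J smooth_term_continuous[OF \<rho>(1)] \<rho>(2) compact_cball[of 0 e] \<rho>(4,5)] by auto
      have JJ0: "0 \<le> JJ x" for x
        unfolding JJ_def conv_def using J(2) \<rho>(2) by (intro integral_nonneg_AE AE_I2) simp
      define k where "k x = \<kappa> * r x ^ 4 + P * r x ^ 3" for x
      define k' where "k' x = \<kappa> * (2 * a * r x ^ 3 * (r x + 1)) + P * (3 / 2 * a * (r x)\<^sup>2 * (r x + 1))" for x
      have du': "has_partial u i (partial i u x) x" "has_partial (partial i u) i (partial i (partial i u) x) x"
        if "x \<in> \<Omega>" for i x using du[OF that] by (auto intro: has_partial_partial)
      have d4: "((\<lambda>t. trunc_exp a t ^ 4) has_real_derivative 2 * a * trunc_exp a t ^ 3 * (trunc_exp a t + 1)) (at t)" for t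
      proof -
        have "Suc (Suc 2) = 4" by simp
        from DERIV_trunc_exp_power[of a 2 t, unfolded this] show ?thesis
          by (rule DERIV_cong) (simp add: eval_nat_numeral field_simps)
      qed
      have d3: "((\<lambda>t. trunc_exp a t ^ 3) has_real_derivative 3 / 2 * a * (trunc_exp a t)\<^sup>2 * (trunc_exp a t + 1)) (at t)" for t
      proof -
        have "Suc (Suc 1) = 3" by simp
        from DERIV_trunc_exp_power[of a 1 t, unfolded this] show ?thesis
          by (rule DERIV_cong) (simp add: eval_nat_numeral field_simps)
      qed
      have dr4: "has_partial (\<lambda>x. r x ^ 4) i (2 * a * r x ^ 3 * (r x + 1) * partial i u x) x" if "x \<in> \<Omega>" for i x
        unfolding r_def by (rule has_partial_compose[OF d4 du'(1)[OF that]])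
      have dk: "has_partial k i (k' x * partial i u x) x" if "x \<in> \<Omega>" for i x
        unfolding k_def k'_def r_def
        by (rule has_partial_compose[OF DERIV_add[OF DERIV_cmult[OF d4] DERIV_cmult[OF d3]] du'(1)[OF that]])

      \<comment> \<open>The two vector fields and their divergences\<close>
      define X where "X i x = r x ^ 4 * W i x / \<Phi> x" for i x
      define X' where "X' i x = ((2 * a * r x ^ 3 * (r x + 1) * partial i u x * W i x + L i x * r x ^ 4) * \<Phi> x
          - r x ^ 4 * W i x * W i x) / (\<Phi> x * \<Phi> x)" for i x
      define Y where "Y i x = k x * partial i u x" for i x
      define Y' where "Y' i x = k' x * partial i u x * partial i u x + partial i (partial i u) x * k x" for i x
      note cU = continuous_on_subset[OF cr U\<Omega>] continuous_on_subset[OF cdu U\<Omega>] continuous_on_subset[OF cuu U\<Omega>]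
      have \<Phi>ne: "\<forall>x\<in>U. \<Phi> x \<noteq> 0" "\<forall>x\<in>U. \<Phi> x * \<Phi> x \<noteq> 0" using \<Phi>pos by fastforce+
      have ck: "continuous_on U k" "continuous_on U k'"
        unfolding k_def k'_def by (intro continuous_intros cU)+
      have rzU: "r x = 0" if "x \<in> U - K" for x using that rz U\<Omega> by auto
      have X: "integrable lborel (\<lambda>x. indicator K x * X' i x)" "(\<integral>x. indicator K x * X' i x \<partial>lborel) = 0" for i
      proof -
        have 1: "continuous_on U (X i)" "continuous_on U (X' i)"
          unfolding X_def X'_def by (intro continuous_intros cU c\<Phi> cW cL \<Phi>ne)+
        have 2: "X i x = 0" "X' i x = 0" if "x \<in> U - K" for x
          using rzU[OF that] by (auto simp: X_def X'_def)
        have 3: "has_partial (X i) i (X' i x) x" if "x \<in> U" for x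
          unfolding X_def X'_def
          by (rule has_partial_divide[OF has_partial_mult[OF dr4 dW] d\<Phi>]) (use that U\<Omega> \<Phi>ne in auto)
        show "integrable lborel (\<lambda>x. indicator K x * X' i x)" "(\<integral>x. indicator K x * X' i x \<partial>lborel) = 0"
          using integral_partial_eq_0_on[OF U(1) K(1) U(2) 1 2 3] by auto
      qed
      have Y: "integrable lborel (\<lambda>x. indicator K x * Y' i x)" "(\<integral>x. indicator K x * Y' i x \<partial>lborel) = 0" for i
      proof -
        have 1: "continuous_on U (Y i)" "continuous_on U (Y' i)"
          unfolding Y_def Y'_def by (intro continuous_intros cU ck)+
        have 2: "Y i x = 0" "Y' i x = 0" if "x \<in> U - K" for x
          using rzU[OF that] by (auto simp: Y_def Y'_def k_def k'_def)
        have 3: "has_partial (Y i) i (Y' i x) x" if "x \<in> U" for x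
          unfolding Y_def Y'_def
          by (rule has_partial_mult[OF dk du'(2)]) (use that U\<Omega> in auto)
        show "integrable lborel (\<lambda>x. indicator K x * Y' i x)" "(\<integral>x. indicator K x * Y' i x \<partial>lborel) = 0"
          using integral_partial_eq_0_on[OF U(1) K(1) U(2) 1 2 3] by auto
      qed
      \<comment> \<open>The sums of \<open>Y'\<close> and \<open>X'\<close> are the two divergences
        in \<open>pointwise_energy_inequality\<close>. The error there is made uniform by
        \<open>r x ^ 4 \<le> M\<close> on \<open>K\<close> and \<open>m \<le> \<Phi> x\<close> on
        \<open>U\<close>.\<close>
      have pw: "lam * exp (u x) * (r x ^ 4 - k x) \<le> (\<Sum>i\<in>UNIV. Y' i x) - (\<Sum>i\<in>UNIV. X' i x) + \<omega> * (M / m) * JJ x"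
        if x: "x \<in> K" for x
      proof -
        have xU: "x \<in> U" and x\<Omega>: "x \<in> \<Omega>" using x U(2) K(2) by auto
        have xK2: "x \<in> K2" using UK2[OF xU, of 0] d by auto
        have pos: "0 < \<Phi> x" using \<Phi>pos[OF xU] .
        define Wx where "Wx = (\<chi> i. W i x)"
        have "c x * conv \<phi>' \<rho> x - \<omega> * conv (\<lambda>y. 2 * (\<Sum>i\<in>UNIV. \<bar>G' i y\<bar>) + \<bar>\<phi>' y\<bar>) \<rho> x
            \<le> - (\<Sum>i\<in>UNIV. conv \<phi>' (partial i (partial i \<rho>)) x)
               - 2 * (\<Sum>i\<in>UNIV. V x $ i * conv \<phi>' (partial i \<rho>) x)"
        proof (rule mollified_supersolution[OF \<Omega>(1) K2 w tr\<phi> trG trH ineq \<rho>(1,2,4) UK2[OF xU e(2)]])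
          fix y i assume y: "y \<in> cball x e"
          then have yK2: "y \<in> K2" using UK2[OF xU e(2)] by auto
          have dist: "dist x y < d1" "dist x y < d2" using y e by auto
          have "\<bar>(V x - V y) $ i\<bar> \<le> norm (V x - V y)" by (rule component_le_norm_cart)
          then show "\<bar>V x $ i - V y $ i\<bar> \<le> \<omega>"
            using d1(2)[OF yK2 xK2 dist(1)] by (simp add: dist_norm)
          show "\<bar>c x - c y\<bar> \<le> \<omega>"
            using d2(2)[OF yK2 xK2 dist(2)] by (simp add: dist_real_def)
        qed
        also have "(\<Sum>i\<in>UNIV. V x $ i * conv \<phi>' (partial i \<rho>) x) = b x * (grad u x \<bullet> Wx)"
          by (simp add: V_def Wx_def W_def inner_vec_def sum_distrib_left mult.assoc)
        finally have st: "lam * exp (u x) * \<Phi> x - \<omega> * JJ x \<le> - (\<Sum>i\<in>UNIV. L i x) - 2 * b x * (grad u x \<bullet> Wx)"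
          by (simp add: c_def \<Phi>_def JJ_def J_eq L_def mult.assoc)
        have wt: "(a * r x * (r x + 1) - b x * (r x)\<^sup>2)\<^sup>2 \<le> k' x - b x * k x"
          unfolding k_def k'_def by (rule weight) (use bnd[OF x\<Omega>] r0 in auto)
        have "lam * exp (u x) * (((r x)\<^sup>2)\<^sup>2 - k x) - ((r x)\<^sup>2)\<^sup>2 * (\<omega> * JJ x) / \<Phi> x
          \<le> (k' x * (norm (grad u x))\<^sup>2 + k x * laplacian u x)
            - (2 * (r x)\<^sup>2 * (a * r x * (r x + 1)) * (grad u x \<bullet> Wx) / \<Phi> x
               + ((r x)\<^sup>2)\<^sup>2 * (\<Sum>i\<in>UNIV. L i x) / \<Phi> x - ((r x)\<^sup>2)\<^sup>2 * (norm Wx)\<^sup>2 / (\<Phi> x)\<^sup>2)"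
          by (rule pointwise_energy_inequality[OF pos st eqn[OF x\<Omega>] wt])
        moreover have "((r x)\<^sup>2)\<^sup>2 = r x ^ 4" by (simp flip: power_mult)
        moreover have "2 * (r x)\<^sup>2 * (a * r x * (r x + 1)) = 2 * a * r x ^ 3 * (r x + 1)"
          by (simp add: power2_eq_square power3_eq_cube)
        moreover have "(\<Sum>i\<in>UNIV. Y' i x) = k' x * (norm (grad u x))\<^sup>2 + k x * laplacian u x"
          unfolding Y'_def power2_norm_eq_inner
          by (simp add: inner_vec_def grad_def laplacian_def sum.distrib sum_distrib_left mult.assoc mult.commute[of _ "k x"])
        moreover have "(\<Sum>i\<in>UNIV. X' i x) = 2 * a * r x ^ 3 * (r x + 1) * (grad u x \<bullet> Wx) / \<Phi> x
               + r x ^ 4 * (\<Sum>i\<in>UNIV. L i x) / \<Phi> x - r x ^ 4 * (norm Wx)\<^sup>2 / (\<Phi> x)\<^sup>2"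
        proof -
          have "X' i x = 2 * a * r x ^ 3 * (r x + 1) / \<Phi> x * (partial i u x * W i x)
               + r x ^ 4 / \<Phi> x * L i x - r x ^ 4 / (\<Phi> x)\<^sup>2 * (W i x * W i x)" for i
            unfolding X'_def using pos by (simp add: divide_simps power2_eq_square)
          then have "(\<Sum>i\<in>UNIV. X' i x) = 2 * a * r x ^ 3 * (r x + 1) / \<Phi> x * (\<Sum>i\<in>UNIV. partial i u x * W i x)
               + r x ^ 4 / \<Phi> x * (\<Sum>i\<in>UNIV. L i x) - r x ^ 4 / (\<Phi> x)\<^sup>2 * (\<Sum>i\<in>UNIV. W i x * W i x)"
            by (simp only: sum.distrib sum_subtractf sum_distrib_left)
          moreover have "(\<Sum>i\<in>UNIV. partial i u x * W i x) = grad u x \<bullet> Wx"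
            by (simp add: inner_vec_def grad_def Wx_def)
          moreover have "(\<Sum>i\<in>UNIV. W i x * W i x) = (norm Wx)\<^sup>2"
            unfolding power2_norm_eq_inner by (simp add: inner_vec_def Wx_def)
          ultimately show ?thesis by simp
        qed
        ultimately have "lam * exp (u x) * (r x ^ 4 - k x) - r x ^ 4 * (\<omega> * JJ x) / \<Phi> x
          \<le> (\<Sum>i\<in>UNIV. Y' i x) - (\<Sum>i\<in>UNIV. X' i x)"
          by simp
        moreover have "r x ^ 4 * (\<omega> * JJ x) / \<Phi> x \<le> \<omega> * (M / m) * JJ x"
        proof -
          have "r x ^ 4 / \<Phi> x \<le> M / m"
            using M(2)[OF x] M(1) \<Phi>m[OF xU] m(1) by (intro frac_le) auto
          then have "r x ^ 4 / \<Phi> x * (\<omega> * JJ x) \<le> M / m * (\<omega> * JJ x)"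
            using \<omega> JJ0 by (intro mult_right_mono) auto
          then show ?thesis by (simp add: mult_ac)
        qed
        ultimately show ?thesis by linarith
      qed

      \<comment> \<open>Integration of the pointwise inequality\<close>
      have "lam * I = (\<integral>x. indicator K x * (lam * exp (u x) * (r x ^ 4 - k x)) \<partial>lborel)"
        unfolding I_def k_def integral_mult_right_zero[symmetric]
        by (intro Bochner_Integration.integral_cong) auto
      also have "\<dots> \<le> (\<integral>x. (\<Sum>i\<in>UNIV. indicator K x * Y' i x) - (\<Sum>i\<in>UNIV. indicator K x * X' i x) + \<omega> * (M / m) * JJ x \<partial>lborel)"
      proof (rule integral_mono)
        have "continuous_on K (\<lambda>x. lam * exp (u x) * (r x ^ 4 - k x))"
          unfolding k_def
          by (intro continuous_intros continuous_on_subset[OF cr K(2)] continuous_on_subset[OF cu K(2)])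
        from borel_integrable_compact[OF K(1) this]
        show "integrable lborel (\<lambda>x. indicator K x * (lam * exp (u x) * (r x ^ 4 - k x)))" by simp
        show "integrable lborel (\<lambda>x. (\<Sum>i\<in>UNIV. indicator K x * Y' i x) - (\<Sum>i\<in>UNIV. indicator K x * X' i x) + \<omega> * (M / m) * JJ x)"
          using X(1) Y(1) JJ(1)
          by (intro Bochner_Integration.integrable_add Bochner_Integration.integrable_diff
              Bochner_Integration.integrable_sum integrable_mult_right) auto
        \<comment> \<open>Off \<open>K\<close> only the nonnegative error term remains, which may
          therefore be integrated over the whole space.\<close>
        show "indicator K x * (lam * exp (u x) * (r x ^ 4 - k x))
            \<le> (\<Sum>i\<in>UNIV. indicator K x * Y' i x) - (\<Sum>i\<in>UNIV. indicator K x * X' i x) + \<omega> * (M / m) * JJ x" for x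
        proof (cases "x \<in> K")
          case True
          then show ?thesis using pw by simp
        next
          case False
          then show ?thesis using \<omega> M m JJ0 by simp
        qed
      qed
      also have "\<dots> = \<omega> * (M / m) * (\<integral>x. JJ x \<partial>lborel)"
      proof -
        define SX SY where "SX x = (\<Sum>i\<in>UNIV. indicator K x * X' i x)" and "SY x = (\<Sum>i\<in>UNIV. indicator K x * Y' i x)" for x
        have "integrable lborel SX" "integrable lborel SY"
          unfolding SX_def SY_def by (intro Bochner_Integration.integrable_sum X(1) Y(1))+
        moreover have "(\<integral>x. SX x \<partial>lborel) = 0" "(\<integral>x. SY x \<partial>lborel) = 0"
          unfolding SX_def SY_def Bochner_Integration.integral_sum[OF X(1)] Bochner_Integration.integral_sum[OF Y(1)]
          by (simp_all add: X(2) Y(2))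
        ultimately have "(\<integral>x. SY x - SX x + \<omega> * (M / m) * JJ x \<partial>lborel) = \<omega> * (M / m) * (\<integral>x. JJ x \<partial>lborel)"
          using JJ(1) by simp
        then show ?thesis unfolding SX_def SY_def .
      qed
      finally show ?thesis by (simp add: JJ(2) mult_ac)
    qed
    have "I \<le> 0"
    proof (rule ccontr)
      assume "\<not> I \<le> 0"
      then have I: "0 < lam * I" using lam by simp
      define C where "C = M / m * (\<integral>y. J y \<partial>lborel)"
      have "0 \<le> C" unfolding C_def using M m J by (intro mult_nonneg_nonneg integral_nonneg_AE) auto
      then have "C / (C + 1) < 1" by simp
      then have "lam * I * (C / (C + 1)) < lam * I * 1" using I by (intro mult_strict_left_mono)
      \<comment> \<open>\<open>main\<close> with \<open>\<omega> = lam * I / (C + 1)\<close>; the 1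
        is added because \<open>C\<close> may be 0.\<close>
      moreover have "lam * I \<le> lam * I / (C + 1) * C"
        unfolding C_def using I \<open>0 \<le> C\<close> by (intro main divide_pos_pos) (auto simp: C_def)
      ultimately show False by simp
    qed
    then show ?thesis by (simp add: I_def r_def)
  qed
qed

text \<open>The quantifier over \<open>C\<close> stands inside the choice of
  \<open>\<Omega>\<close>, \<open>b\<close> and \<open>q\<close> but outside that of
  \<open>lam\<close> and \<open>u\<close>, which expresses the claimed dependence.
  \<open>in_Lp\<close> is asserted as well because \<open>Lp_norm\<close> alone would be 0 for a
  function without finite integral.\<close>

theorem proposition4p1:
  fixes \<Omega> :: "(real^'n) set" and b :: "real^'n \<Rightarrow> real" and q :: real
  assumes "smooth_bounded_domain \<Omega>" and "0 < q"
  shows "\<exists>C. \<forall>blow bup \<delta> \<eta> lam u.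
    (\<forall>x\<in>\<Omega>. blow \<le> b x \<and> b x \<le> bup) \<and> 0 < bup \<and>
    0 < \<delta> \<and> 0 < \<eta> \<and> \<delta>\<^sup>2 + \<eta>\<^sup>2 \<le> 1 \<and>
    bup - blow < \<delta>\<^sup>2 / \<eta>\<^sup>2 * (\<eta>\<^sup>2 - bup / 8) \<and>
    q < 1 + 2 * \<eta>\<^sup>2 + 2 * bup
          + 2 * sqrt (\<eta>\<^sup>2 * (\<eta>\<^sup>2 + bup) - 2 * bup * (bup - blow) * (\<eta>\<^sup>2 / \<delta>\<^sup>2)) \<and>
    0 < lam \<and> stable_solution \<Omega> b lam exp u \<and> (\<forall>x\<in>\<Omega>. 0 < u x)
    \<longrightarrow> in_Lp q \<Omega> (\<lambda>x. exp (u x)) \<and> Lp_norm q \<Omega> (\<lambda>x. exp (u x)) \<le> C"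
proof -
  have \<Omega>: "open \<Omega>" "bounded \<Omega>" "\<Omega> \<noteq> {}"
    using assms(1) by (auto simp: smooth_bounded_domain_def)
  \<comment> \<open>The hypotheses on \<open>u\<close> and \<open>lam\<close> do not involve \<open>blow\<close>, \<open>bup\<close>, \<open>\<delta>\<close>, \<open>\<eta>\<close>,
    so a constant obtained from a single admissible choice serves for all of them.\<close>
  define adm where "adm blow bup \<delta> \<eta> \<longleftrightarrow>
    (\<forall>x\<in>\<Omega>. blow \<le> b x \<and> b x \<le> bup) \<and> 0 < bup \<and>
    0 < \<delta> \<and> 0 < \<eta> \<and> \<delta>\<^sup>2 + \<eta>\<^sup>2 \<le> 1 \<and>
    bup - blow < \<delta>\<^sup>2 / \<eta>\<^sup>2 * (\<eta>\<^sup>2 - bup / 8) \<and>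
    q < 1 + 2 * \<eta>\<^sup>2 + 2 * bup
          + 2 * sqrt (\<eta>\<^sup>2 * (\<eta>\<^sup>2 + bup) - 2 * bup * (bup - blow) * (\<eta>\<^sup>2 / \<delta>\<^sup>2))"
    for blow bup \<delta> \<eta> :: real
  have "\<exists>C. \<forall>lam u. 0 < lam \<and> stable_solution \<Omega> b lam exp u
      \<longrightarrow> in_Lp q \<Omega> (\<lambda>x. exp (u x)) \<and> Lp_norm q \<Omega> (\<lambda>x. exp (u x)) \<le> C"
    if "adm blow bup \<delta> \<eta>" for blow bup \<delta> \<eta>
  proof -
    have bnd: "blow \<le> b x \<and> b x \<le> bup" if "x \<in> \<Omega>" for x
      using \<open>adm blow bup \<delta> \<eta>\<close> that by (simp add: adm_def)
    obtain z where "z \<in> \<Omega>" using \<Omega>(3) by blast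
    have blow: "blow \<le> bup" using bnd[OF \<open>z \<in> \<Omega>\<close>] by linarith
    have pos: "0 < bup" using that by (simp add: adm_def)
    have "bup < 1 + blow \<and> (\<exists>s. 0 < s \<and> s < 1 \<and> q \<le> 1 + 2 * ((sqrt (1 + blow))\<^sup>2 + s * sqrt (1 + blow)))"
      using exponent_below_threshold[of blow bup \<delta> \<eta> q] blow that by (simp add: adm_def)
    then obtain s where bup: "bup < 1 + blow" and s: "0 < s" "s < 1"
      and q: "q \<le> 1 + 2 * ((sqrt (1 + blow))\<^sup>2 + s * sqrt (1 + blow))" by blast
    define R where "R = sqrt (1 + blow)"
    have R: "0 < R" "R\<^sup>2 = 1 + blow" using bup pos by (auto simp: R_def)
    define a where "a = R\<^sup>2 + s * R"
    have a: "0 < a" unfolding a_def using R(1) s by (intro add_pos_pos) auto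
    obtain \<kappa> P where \<kappa>: "\<kappa> < 1" and P: "0 \<le> P"
      and weight: "\<And>b r. blow \<le> b \<Longrightarrow> b \<le> bup \<Longrightarrow> 0 \<le> r \<Longrightarrow> (a * r * (r + 1) - b * r\<^sup>2)\<^sup>2 \<le>
       \<kappa> * (2 * a * r ^ 3 * (r + 1)) + P * (3 / 2 * a * r\<^sup>2 * (r + 1)) - b * (\<kappa> * r ^ 4 + P * r ^ 3)"
      using exists_weight_constants[OF R s pos bup] unfolding a_def by blast
    have "q \<le> 1 + 2 * a" using q by (simp add: a_def R_def)
    then obtain A B where B: "0 \<le> B" and AB: "\<And>t. 1 \<le> t \<Longrightarrow> exp (q * t) \<le>
       A + B * (exp t * ((1 - \<kappa>) * trunc_exp a t ^ 4 - P * trunc_exp a t ^ 3))"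
      using exp_le_weight[OF a _ P, of "1 - \<kappa>" q] \<kappa> by force
    \<comment> \<open>The first summand serves the points where \<open>u \<ge> 1\<close>, the second
      those where \<open>u < 1\<close> and hence \<open>q * u x \<le> q\<close>.\<close>
    define A' where "A' = max A 0 + exp q"
    define C where "C = (A' * measure lborel \<Omega>) powr (1 / q)"
    have "in_Lp q \<Omega> (\<lambda>x. exp (u x)) \<and> Lp_norm q \<Omega> (\<lambda>x. exp (u x)) \<le> C"
      if lam: "0 < lam" and stable: "stable_solution \<Omega> b lam exp u" for lam u
    proof -
      have ucl: "continuous_on (closure \<Omega>) u" and u0: "\<And>x. x \<in> frontier \<Omega> \<Longrightarrow> u x = 0"
        using stable by (auto simp: stable_solution_def classical_solution_def)
      define K where "K = {x \<in> closure \<Omega>. 1 \<le> u x}"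
      have K: "compact K" "K \<subseteq> \<Omega>"
        unfolding K_def using superlevel_compact[OF \<Omega>(1,2) ucl u0] by auto
      define g where "g x = indicator K x * (exp (u x) *
        ((1 - \<kappa>) * trunc_exp a (u x) ^ 4 - P * trunc_exp a (u x) ^ 3))" for x
      have uK: "continuous_on K u"
        using ucl by (rule continuous_on_subset) (auto simp: K_def)
      have "continuous_on K (\<lambda>x. exp (u x) *
        ((1 - \<kappa>) * trunc_exp a (u x) ^ 4 - P * trunc_exp a (u x) ^ 3))"
        by (intro continuous_intros uK continuous_on_compose2[OF continuous_on_trunc_exp uK]) auto
      from borel_integrable_compact[OF K(1) this]
      have intg: "integrable lborel g" by (simp add: g_def[abs_def])
      \<comment> \<open>\<open>g\<close> is the integrand of the energy estimate with its quartic
        terms collected; \<open>lam\<close> has dropped out of it.\<close>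
      have "(\<integral>x. g x \<partial>lborel) \<le> 0"
        using energy_estimate[OF \<Omega>(1,2) lam stable bnd less_imp_le[OF a] weight]
        by (simp add: g_def K_def algebra_simps)
      have cl: "compact (closure \<Omega>)" using \<Omega>(2) by (simp add: compact_closure)
      have "continuous_on (closure \<Omega>) (\<lambda>x. exp (q * u x))"
        by (intro continuous_intros ucl)
      from borel_integrable_compact[OF cl this]
      have "integrable lborel (\<lambda>x. indicator (closure \<Omega>) x * exp (q * u x))" by simp
      then have "integrable lborel (\<lambda>x. indicator \<Omega> x * (indicator (closure \<Omega>) x * exp (q * u x)))"
        using \<Omega>(1) integrable_mult_indicator[of \<Omega> lborel "\<lambda>x. indicator (closure \<Omega>) x * exp (q * u x)"] by simp
      also have "(\<lambda>x. indicator \<Omega> x * (indicator (closure \<Omega>) x * exp (q * u x)))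
          = (\<lambda>x. indicator \<Omega> x * exp (q * u x))"
        using closure_subset[of \<Omega>] by (auto simp: indicator_def fun_eq_iff)
      finally have inte: "integrable lborel (\<lambda>x. indicator \<Omega> x * exp (q * u x))" .
      have powr: "\<bar>exp (u x)\<bar> powr q = exp (q * u x)" for x
        by (simp add: powr_def)
      have "integrable lebesgue (\<lambda>x. indicator \<Omega> x * exp (q * u x))"
        using inte integrable_completion[of "\<lambda>x. indicator \<Omega> x * exp (q * u x)" lborel]
        by (auto dest: borel_measurable_integrable)
      then have int: "integrable (lebesgue_on \<Omega>) (\<lambda>x. exp (q * u x))"
        using \<Omega>(1) by (simp add: integrable_restrict_space)
      have "(\<lambda>x. exp (u x)) \<in> borel_measurable (lebesgue_on \<Omega>)"
      proof (rule continuous_imp_measurable_on_sets_lebesgue)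
        show "continuous_on \<Omega> (\<lambda>x. exp (u x))"
          by (intro continuous_intros continuous_on_subset[OF ucl closure_subset])
      qed (use \<Omega>(1) in auto)
      then have Lp: "in_Lp q \<Omega> (\<lambda>x. exp (u x))" using int unfolding in_Lp_def powr by blast
      have fin: "emeasure lborel \<Omega> < \<infinity>"
        using \<Omega>(2) by (rule emeasure_bounded_finite)
      have intA: "integrable lborel (\<lambda>x. A' * indicator \<Omega> x)"
        using fin \<Omega>(1) by (intro integrable_mult_right integrable_real_indicator) auto
      have "(\<integral>x. exp (q * u x) \<partial>lebesgue_on \<Omega>) = (\<integral>x. indicator \<Omega> x * exp (q * u x) \<partial>lebesgue)"
        using \<Omega>(1) by (simp add: integral_restrict_space)
      also have "\<dots> = (\<integral>x. indicator \<Omega> x * exp (q * u x) \<partial>lborel)"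
        using inte by (intro integral_completion) auto
      also have "\<dots> \<le> (\<integral>x. A' * indicator \<Omega> x + B * g x \<partial>lborel)"
      proof (rule integral_mono[OF inte])
        show "integrable lborel (\<lambda>x. A' * indicator \<Omega> x + B * g x)"
          using intA intg by simp
        show "indicator \<Omega> x * exp (q * u x) \<le> A' * indicator \<Omega> x + B * g x" for x
        proof (cases "x \<in> \<Omega>")
          case False
          then have "x \<notin> K" using K(2) by auto
          with False show ?thesis by (simp add: g_def)
        next
          case True
          show ?thesis
          proof (cases "1 \<le> u x")
            case True
            with \<open>x \<in> \<Omega>\<close> have "x \<in> K" using closure_subset[of \<Omega>] by (auto simp: K_def)
            moreover have "A \<le> A'" unfolding A'_def by (simp add: add_increasing2)
            ultimately show ?thesis using AB[OF True] \<open>x \<in> \<Omega>\<close> by (simp add: g_def)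
          next
            case False
            then have "q * u x \<le> q" using assms(2) by (simp add: mult_left_le)
            then have "exp (q * u x) \<le> A'" unfolding A'_def by (simp add: add_increasing)
            moreover have "x \<notin> K" using False by (simp add: K_def)
            ultimately show ?thesis using \<open>x \<in> \<Omega>\<close> by (simp add: g_def)
          qed
        qed
      qed
      also have "\<dots> = A' * measure lborel \<Omega> + B * (\<integral>x. g x \<partial>lborel)"
        using intA intg by simp
      also have "\<dots> \<le> A' * measure lborel \<Omega>"
        using B \<open>(\<integral>x. g x \<partial>lborel) \<le> 0\<close> by (simp add: mult_nonneg_nonpos)
      finally have "(\<integral>x. exp (q * u x) \<partial>lebesgue_on \<Omega>) \<le> A' * measure lborel \<Omega>" .
      then have "Lp_norm q \<Omega> (\<lambda>x. exp (u x)) \<le> C"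
        unfolding Lp_norm_def powr C_def using assms(2) by (intro powr_mono2) auto
      with Lp show ?thesis by blast
    qed
    then show ?thesis by blast
  qed
  then have "\<exists>C. \<forall>blow bup \<delta> \<eta> lam u. adm blow bup \<delta> \<eta> \<and> 0 < lam \<and> stable_solution \<Omega> b lam exp u
      \<longrightarrow> in_Lp q \<Omega> (\<lambda>x. exp (u x)) \<and> Lp_norm q \<Omega> (\<lambda>x. exp (u x)) \<le> C"
    \<comment> \<open>Without any admissible parameters every \<open>C\<close> works
      vacuously.\<close>
    by (cases "\<exists>blow bup \<delta> \<eta>. adm blow bup \<delta> \<eta>") blast+
  then show ?thesis unfolding adm_def by blast
qed

end
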